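(* Let $C$ be the random output of the procedure SampleOneCluster run on an optimal solution $\{y_S^s\}$ of the bounded sub-cluster LP. Then $$\sum_{uv\in\binom V2}w_{uv}\left|\mathbb P[u,v\in C]-\frac{y_{uv}}{y_\emptyset}\right|\le\frac{\varepsilon\,\mathrm{OPT}}{y_\emptyset}.$$
   Context: Instance: a set $V$ of $n\ge2$ vertices; $\binom V2=E^+\uplus E^-$ (positive/negative pairs, arbitrary); weights $w_{uv}=w_{vu}\ge0$, $w_{uu}=0$, $w_{uv}\le w_{ua}+w_{av}$ for all $u,v,a\in V$. For a partition (clustering) $\mathcal C$ of $V$, $\operatorname{obj}(\mathcal C)$ is the total weight of positive pairs whose endpoints lie in different parts plus the total weight of negative pairs whose endpoints lie in the same part; $\mathrm{OPT}=\min_{\mathcal C}\operatorname{obj}(\mathcal C)$. For $A,B\subseteq V$, $w(A,B)=\sum_{a\in A}\sum_{b\in B}w_{ab}$; $w^+(A,B)$ is the same sum restricted to positive pairs; $w(u,A)=w(\{u\},A)$. $N_u^+=\{v\ne u:uv\in E^+\}$. Fix $\varepsilon\in(0,1]$. Atoms. Fix an absolute constant $\beta$ with $0<\beta\le\frac{2\sqrt7-5}{6}$ and a clustering $\mathcal C^0$ with $\operatorname{obj}(\mathcal C^0)\le\frac{20}3\mathrm{OPT}$. For $u\in C\in\mathcal C^0$ put $d_C(u)=w(u,N_u^+\triangle C)$ and $M_C=\{u\in C:d_C(u)>\frac\beta2w(u,C)\}$. The atom partition $\mathcal K$ is obtained by processing each $C\in\mathcal C^0$: if $\sum_{u\in M_C}d_C(u)>\frac{\beta^2}{20}w(C,C)$,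 put every singleton $\{u\}$, $u\in C$, in $\mathcal K$; otherwise put $\{u\}$ in $\mathcal K$ for each $u\in M_C$, and also $C\setminus M_C$ if nonempty. $\alpha\ge1$ is a fixed absolute constant (depending only on $\beta$) such that $\operatorname{obj}(\mathcal K)\le\alpha\,\mathrm{OPT}$ always holds. Admissible pairs. For an atom $K$ let $d(K)=\sum_{L\in\mathcal K,L\ne K}w^+(K,L)$; $\mathcal K_+=\{K:d(K)>0\}$. On $\mathcal K_+$ let $D=\operatorname{diag}(d(K))$, $P(K,L)=w^+(K,L)/d(K)$ for $K\ne L$, $P(K,K)=0$, $t_0=297$, $Q=P((I+P)/2)^{t_0}$, $\Gamma=DQD^{-1}Q^\top D$, extended by zeros to $\mathcal K$. With $\tau=\varepsilon/(2\alpha)$, a pair $uv$ with $u,v$ in distinct atoms $K_u,K_v$ is in $E_{\mathrm{adm}}$ iff $w(K_u,K_v)<64\tau^{-(2t_0+1)}\Gamma_{K_u,K_v}$. Pairs inside one atom are not in $E_{\mathrm{adm}}$. It is known that $\sum_{uv\in E_{\mathrm{adm}}}w_{uv}\le R_\varepsilon\mathrm{OPT}$, where $R_\varepsilon=\max\{1,\alpha,128\alpha(2\alpha/\varepsilon)^{2t_0+1}\}$. Bounded sub-cluster LP. Let $r=2+\lceil 2\ln2\,R_\varepsilon^2/\varepsilon^2\rceil$. Variables $y_S^s$ for $s\in[n]$, $S\subseteq V$, $|S|\le r$; write $y_S=\sum_{s=1}^ny_S^s$, $Su=S\cup\{u\}$, $y_u=y_{\{u\}}$, $y_{uv}=y_{\{u,v\}}$.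 Minimize $\sum_{uv\in E^+}w_{uv}(1-y_{uv})+\sum_{uv\in E^-}w_{uv}y_{uv}$ subject to: $y_u=1$ for all $u$; $\frac1s\sum_{u\in V}y_{Su}^s=y_S^s$ for $s\in[n]$, $|S|\le r-1$; $y_S^s\ge0$; $y_{uv}=1$ for distinct $u,v$ in one atom; $y_{uv}=0$ for $u,v$ in distinct atoms with $uv\notin E_{\mathrm{adm}}$; $0\le\sum_{T'\subseteq T}(-1)^{|T'|}y_{S\cup T'}^s\le y_S^s$ for $s\in[n]$, $S\cap T=\emptyset$, $|S\cup T|\le r$. Its optimum is at most $(1+\varepsilon)\mathrm{OPT}$. Fix an optimal solution; $1\le y_\emptyset\le n$. SampleOneCluster. Sample $s\in[n]$ with probability $y_\emptyset^s/y_\emptyset$; sample $T$ uniformly from $\{1,\dots,r-2\}$ (independently of $s$). Set $U=\emptyset$; for $t=1,\dots,T$ sample $u_t\in V$ with probability $y_{Uu_t}^s/(s\,y_U^s)$ and replace $U$ by $U\cup\{u_t\}$. Then, independently for each atom $K\in\mathcal K$, include all of $K$ in $C$ with probability $y_{Uv}^s/y_U^s$, where $v\in K$ is any representative (the value does not depend on the choice). Output $C$. *)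

theory Defs
  imports "HOL-Probability.Probability" "HOL-Library.Disjoint_Sets" "HOL-Library.Ramsey"
begin

section \<open>Correlation clustering instances\<close>

text \<open>The unordered pairs of vertices are \<^term>\<open>nsets V 2\<close>. The summand \<open>f\<close> is
  symmetric in every use below; each pair \<open>{u, v}\<close> of \<open>E\<close> is met twice by the ordered sum, hence
  the factor one half.\<close>

definition edge_sum :: "'a set set \<Rightarrow> ('a \<Rightarrow> 'a \<Rightarrow> real) \<Rightarrow> real" where
  "edge_sum E f = (\<Sum>(u, v) \<in> {(u, v). u \<noteq> v \<and> {u, v} \<in> E}. f u v) / 2"

definition cc_instance ::
  "'a set \<Rightarrow> 'a set set \<Rightarrow> 'a set set \<Rightarrow> ('a \<Rightarrow> 'a \<Rightarrow> real) \<Rightarrow> bool" where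
  "cc_instance V Ep Em w \<longleftrightarrow>
     finite V \<and> card V \<ge> 2 \<and>
     Ep \<union> Em = nsets V 2 \<and> Ep \<inter> Em = {} \<and>
     (\<forall>u\<in>V. \<forall>v\<in>V. w u v = w v u \<and> w u v \<ge> 0) \<and>
     (\<forall>u\<in>V. w u u = 0) \<and>
     (\<forall>u\<in>V. \<forall>v\<in>V. \<forall>a\<in>V. w u v \<le> w u a + w a v)"

definition obj :: "'a set set \<Rightarrow> 'a set set \<Rightarrow> ('a \<Rightarrow> 'a \<Rightarrow> real) \<Rightarrow> 'a set set \<Rightarrow> real" where
  "obj Ep Em w \<C> =
     edge_sum {e \<in> Ep. \<not> (\<exists>C\<in>\<C>. e \<subseteq> C)} w + edge_sum {e \<in> Em. \<exists>C\<in>\<C>. e \<subseteq> C} w"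

definition opt :: "'a set \<Rightarrow> 'a set set \<Rightarrow> 'a set set \<Rightarrow> ('a \<Rightarrow> 'a \<Rightarrow> real) \<Rightarrow> real" where
  "opt V Ep Em w = Min (obj Ep Em w ` {\<C>. partition_on V \<C>})"

definition wsum :: "('a \<Rightarrow> 'a \<Rightarrow> real) \<Rightarrow> 'a set \<Rightarrow> 'a set \<Rightarrow> real" where
  "wsum w A B = (\<Sum>a\<in>A. \<Sum>b\<in>B. w a b)"

definition wpos :: "'a set set \<Rightarrow> ('a \<Rightarrow> 'a \<Rightarrow> real) \<Rightarrow> 'a set \<Rightarrow> 'a set \<Rightarrow> real" where
  "wpos Ep w A B = (\<Sum>a\<in>A. \<Sum>b\<in>B. if {a, b} \<in> Ep then w a b else 0)"

definition pos_nbrs :: "'a set set \<Rightarrow> 'a \<Rightarrow> 'a set" where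
  "pos_nbrs Ep u = {v. v \<noteq> u \<and> {u, v} \<in> Ep}"


section \<open>Atoms\<close>

definition disagr :: "'a set set \<Rightarrow> ('a \<Rightarrow> 'a \<Rightarrow> real) \<Rightarrow> 'a set \<Rightarrow> 'a \<Rightarrow> real" where
  "disagr Ep w C u = wsum w {u} ((pos_nbrs Ep u - C) \<union> (C - pos_nbrs Ep u))"

definition marked :: "'a set set \<Rightarrow> ('a \<Rightarrow> 'a \<Rightarrow> real) \<Rightarrow> real \<Rightarrow> 'a set \<Rightarrow> 'a set" where
  "marked Ep w \<beta> C = {u \<in> C. disagr Ep w C u > \<beta> / 2 * wsum w {u} C}"

definition atoms_of :: "'a set set \<Rightarrow> ('a \<Rightarrow> 'a \<Rightarrow> real) \<Rightarrow> real \<Rightarrow> 'a set \<Rightarrow> 'a set set" where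
  "atoms_of Ep w \<beta> C =
     (let M = marked Ep w \<beta> C in
      if (\<Sum>u\<in>M. disagr Ep w C u) > \<beta>\<^sup>2 / 20 * wsum w C C
      then (\<lambda>u. {u}) ` C
      else (\<lambda>u. {u}) ` M \<union> (if C - M = {} then {} else {C - M}))"

definition atoms :: "'a set set \<Rightarrow> ('a \<Rightarrow> 'a \<Rightarrow> real) \<Rightarrow> real \<Rightarrow> 'a set set \<Rightarrow> 'a set set" where
  "atoms Ep w \<beta> \<C>0 = (\<Union>C\<in>\<C>0. atoms_of Ep w \<beta> C)"

text \<open>\<open>\<alpha>\<close> is a constant that works for all instances and all admissible initial clusterings at
  once. The type argument only names the type from which the vertices are drawn.\<close>

definition atom_constant :: "'a itself \<Rightarrow> real \<Rightarrow> real \<Rightarrow> bool" where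
  "atom_constant (_ :: 'a itself) \<beta> \<alpha> \<longleftrightarrow>
     \<alpha> \<ge> 1 \<and>
     (\<forall>(V :: 'a set) Ep Em w \<C>0.
        cc_instance V Ep Em w \<longrightarrow> partition_on V \<C>0 \<longrightarrow>
        obj Ep Em w \<C>0 \<le> 20 / 3 * opt V Ep Em w \<longrightarrow>
        obj Ep Em w (atoms Ep w \<beta> \<C>0) \<le> \<alpha> * opt V Ep Em w)"


section \<open>Admissible pairs\<close>

text \<open>Real matrices with rows and columns indexed by a finite set \<open>I\<close> are functions of two
  arguments; only the values on \<open>I\<close> are meaningful.\<close>

definition mmul ::
  "'i set \<Rightarrow> ('i \<Rightarrow> 'i \<Rightarrow> real) \<Rightarrow> ('i \<Rightarrow> 'i \<Rightarrow> real) \<Rightarrow> 'i \<Rightarrow> 'i \<Rightarrow> real" where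
  "mmul I A B = (\<lambda>i j. \<Sum>k\<in>I. A i k * B k j)"

definition mdiag :: "('i \<Rightarrow> real) \<Rightarrow> 'i \<Rightarrow> 'i \<Rightarrow> real" where
  "mdiag d = (\<lambda>i j. if i = j then d i else 0)"

definition mtransp :: "('i \<Rightarrow> 'i \<Rightarrow> real) \<Rightarrow> 'i \<Rightarrow> 'i \<Rightarrow> real" where
  "mtransp A = (\<lambda>i j. A j i)"

primrec mpow :: "'i set \<Rightarrow> ('i \<Rightarrow> 'i \<Rightarrow> real) \<Rightarrow> nat \<Rightarrow> 'i \<Rightarrow> 'i \<Rightarrow> real" where
  "mpow I A 0 = mdiag (\<lambda>_. 1)"
| "mpow I A (Suc k) = mmul I A (mpow I A k)"

definition t0 :: nat where
  "t0 = 297"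

definition adeg :: "'a set set \<Rightarrow> ('a \<Rightarrow> 'a \<Rightarrow> real) \<Rightarrow> 'a set set \<Rightarrow> 'a set \<Rightarrow> real" where
  "adeg Ep w \<K> K = (\<Sum>L \<in> \<K> - {K}. wpos Ep w K L)"

definition atoms_plus :: "'a set set \<Rightarrow> ('a \<Rightarrow> 'a \<Rightarrow> real) \<Rightarrow> 'a set set \<Rightarrow> 'a set set" where
  "atoms_plus Ep w \<K> = {K \<in> \<K>. adeg Ep w \<K> K > 0}"

definition walkP ::
  "'a set set \<Rightarrow> ('a \<Rightarrow> 'a \<Rightarrow> real) \<Rightarrow> 'a set set \<Rightarrow> 'a set \<Rightarrow> 'a set \<Rightarrow> real" where
  "walkP Ep w \<K> = (\<lambda>K L. if K = L then 0 else wpos Ep w K L / adeg Ep w \<K> K)"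

definition walkQ ::
  "'a set set \<Rightarrow> ('a \<Rightarrow> 'a \<Rightarrow> real) \<Rightarrow> 'a set set \<Rightarrow> 'a set \<Rightarrow> 'a set \<Rightarrow> real" where
  "walkQ Ep w \<K> =
     (let P = walkP Ep w \<K>; I = atoms_plus Ep w \<K> in
      mmul I P (mpow I (\<lambda>K L. (mdiag (\<lambda>_. 1) K L + P K L) / 2) t0))"

definition Gam ::
  "'a set set \<Rightarrow> ('a \<Rightarrow> 'a \<Rightarrow> real) \<Rightarrow> 'a set set \<Rightarrow> 'a set \<Rightarrow> 'a set \<Rightarrow> real" where
  "Gam Ep w \<K> =
     (let I = atoms_plus Ep w \<K>; Q = walkQ Ep w \<K>;
          D = mdiag (adeg Ep w \<K>); Dinv = mdiag (\<lambda>K. 1 / adeg Ep w \<K> K) in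
      (\<lambda>K L. if K \<in> I \<and> L \<in> I
             then mmul I D (mmul I Q (mmul I Dinv (mmul I (mtransp Q) D))) K L
             else 0))"

definition adm_pairs ::
  "'a set set \<Rightarrow> ('a \<Rightarrow> 'a \<Rightarrow> real) \<Rightarrow> 'a set set \<Rightarrow> real \<Rightarrow> real \<Rightarrow> 'a set set" where
  "adm_pairs Ep w \<K> \<alpha> \<epsilon> =
     (let \<tau> = \<epsilon> / (2 * \<alpha>) in
      {{u, v} | u v K L. K \<in> \<K> \<and> L \<in> \<K> \<and> K \<noteq> L \<and> u \<in> K \<and> v \<in> L \<and>
         wsum w K L < 64 / \<tau> ^ (2 * t0 + 1) * Gam Ep w \<K> K L})"


section \<open>The bounded sub-cluster LP\<close>

definition R_const :: "real \<Rightarrow> real \<Rightarrow> real" where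
  "R_const \<alpha> \<epsilon> = Max {1, \<alpha>, 128 * \<alpha> * (2 * \<alpha> / \<epsilon>) ^ (2 * t0 + 1)}"

definition lp_rank :: "real \<Rightarrow> real \<Rightarrow> nat" where
  "lp_rank \<alpha> \<epsilon> = 2 + nat \<lceil>2 * ln 2 * (R_const \<alpha> \<epsilon>)\<^sup>2 / \<epsilon>\<^sup>2\<rceil>"

text \<open>A solution is a function \<open>y\<close> with \<open>y s S\<close> the variable \<open>y\<^sub>S\<^sup>s\<close>; values with
  \<open>s \<notin> {1..card V}\<close>, \<open>\<not> S \<subseteq> V\<close> or \<open>card S > r\<close> are not variables and are never read.\<close>

definition ytot :: "'a set \<Rightarrow> (nat \<Rightarrow> 'a set \<Rightarrow> real) \<Rightarrow> 'a set \<Rightarrow> real" where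
  "ytot V y S = (\<Sum>s = 1..card V. y s S)"

definition lp_value ::
  "'a set \<Rightarrow> 'a set set \<Rightarrow> 'a set set \<Rightarrow> ('a \<Rightarrow> 'a \<Rightarrow> real) \<Rightarrow> (nat \<Rightarrow> 'a set \<Rightarrow> real) \<Rightarrow> real" where
  "lp_value V Ep Em w y =
     edge_sum Ep (\<lambda>u v. w u v * (1 - ytot V y {u, v})) +
     edge_sum Em (\<lambda>u v. w u v * ytot V y {u, v})"

definition lp_feasible ::
  "'a set \<Rightarrow> 'a set set \<Rightarrow> 'a set set \<Rightarrow> nat \<Rightarrow> (nat \<Rightarrow> 'a set \<Rightarrow> real) \<Rightarrow> bool" where
  "lp_feasible V \<K> A r y \<longleftrightarrow>
     (\<forall>u\<in>V. ytot V y {u} = 1) \<and>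
     (\<forall>s\<in>{1..card V}. \<forall>S. S \<subseteq> V \<longrightarrow> card S \<le> r - 1 \<longrightarrow>
        1 / real s * (\<Sum>u\<in>V. y s (S \<union> {u})) = y s S) \<and>
     (\<forall>s\<in>{1..card V}. \<forall>S. S \<subseteq> V \<longrightarrow> card S \<le> r \<longrightarrow> y s S \<ge> 0) \<and>
     (\<forall>K\<in>\<K>. \<forall>u\<in>K. \<forall>v\<in>K. u \<noteq> v \<longrightarrow> ytot V y {u, v} = 1) \<and>
     (\<forall>K\<in>\<K>. \<forall>L\<in>\<K>. K \<noteq> L \<longrightarrow> (\<forall>u\<in>K. \<forall>v\<in>L. {u, v} \<notin> A \<longrightarrow> ytot V y {u, v} = 0)) \<and>
     (\<forall>s\<in>{1..card V}. \<forall>S T. S \<subseteq> V \<longrightarrow> T \<subseteq> V \<longrightarrow> S \<inter> T = {} \<longrightarrow> card (S \<union> T) \<le> r \<longrightarrow>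
        0 \<le> (\<Sum>T'\<in>Pow T. (- 1) ^ card T' * y s (S \<union> T')) \<and>
        (\<Sum>T'\<in>Pow T. (- 1) ^ card T' * y s (S \<union> T')) \<le> y s S)"

definition lp_optimal ::
  "'a set \<Rightarrow> 'a set set \<Rightarrow> 'a set set \<Rightarrow> ('a \<Rightarrow> 'a \<Rightarrow> real) \<Rightarrow> 'a set set \<Rightarrow> 'a set set \<Rightarrow> nat \<Rightarrow>
     (nat \<Rightarrow> 'a set \<Rightarrow> real) \<Rightarrow> bool" where
  "lp_optimal V Ep Em w \<K> A r y \<longleftrightarrow>
     lp_feasible V \<K> A r y \<and>
     (\<forall>y'. lp_feasible V \<K> A r y' \<longrightarrow> lp_value V Ep Em w y \<le> lp_value V Ep Em w y')"


section \<open>SampleOneCluster\<close>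

text \<open>For feasible \<open>y\<close>, every weight function given to \<^const>\<open>embed_pmf\<close> below that is reached with
  positive probability is nonnegative with total mass one, and every parameter given to
  \<^const>\<open>bernoulli_pmf\<close> in such a run lies in the unit interval. Runs of probability zero (those with
  \<open>y s U = 0\<close>) do not affect the output distribution.\<close>

definition pick_size :: "'a set \<Rightarrow> (nat \<Rightarrow> 'a set \<Rightarrow> real) \<Rightarrow> nat pmf" where
  "pick_size V y = embed_pmf (\<lambda>s. if s \<in> {1..card V} then y s {} / ytot V y {} else 0)"

definition pick_vertex :: "'a set \<Rightarrow> (nat \<Rightarrow> 'a set \<Rightarrow> real) \<Rightarrow> nat \<Rightarrow> 'a set \<Rightarrow> 'a pmf" where
  "pick_vertex V y s U =
     embed_pmf (\<lambda>u. if u \<in> V then y s (U \<union> {u}) / (real s * y s U) else 0)"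

primrec pick_seeds ::
  "'a set \<Rightarrow> (nat \<Rightarrow> 'a set \<Rightarrow> real) \<Rightarrow> nat \<Rightarrow> nat \<Rightarrow> 'a set \<Rightarrow> 'a set pmf" where
  "pick_seeds V y s 0 U = return_pmf U"
| "pick_seeds V y s (Suc t) U =
     bind_pmf (pick_vertex V y s U) (\<lambda>u. pick_seeds V y s t (U \<union> {u}))"

text \<open>\<open>rep K\<close> is the representative of the atom \<open>K\<close>.\<close>

definition pick_atoms ::
  "'a set set \<Rightarrow> ('a set \<Rightarrow> 'a) \<Rightarrow> (nat \<Rightarrow> 'a set \<Rightarrow> real) \<Rightarrow> nat \<Rightarrow> 'a set \<Rightarrow> 'a set pmf" where
  "pick_atoms \<K> rep y s U =
     map_pmf (\<lambda>b. \<Union>{K \<in> \<K>. b K})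
       (Pi_pmf \<K> False (\<lambda>K. bernoulli_pmf (y s (U \<union> {rep K}) / y s U)))"

definition sample_one_cluster ::
  "'a set \<Rightarrow> 'a set set \<Rightarrow> nat \<Rightarrow> ('a set \<Rightarrow> 'a) \<Rightarrow> (nat \<Rightarrow> 'a set \<Rightarrow> real) \<Rightarrow> 'a set pmf" where
  "sample_one_cluster V \<K> r rep y =
     bind_pmf (pick_size V y) (\<lambda>s.
     bind_pmf (pmf_of_set {1..r - 2}) (\<lambda>T.
     bind_pmf (pick_seeds V y s T {}) (\<lambda>U.
     pick_atoms \<K> rep y s U)))"

end

theory Submission
  imports Defs
begin

text \<open>For a fixed size \<open>s\<close> the variables \<open>y\<^sup>s\<close> behave like the inclusion probabilities of a random cluster
  of size \<open>s\<close>, and conditioning on the seeds is a martingale; so the error of a pair \<open>uv\<close> in distinct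
  atoms is the expected conditional covariance of the events \<open>u \<in> C\<close> and \<open>v \<in> C\<close>, while pairs inside an
  atom have no error. A further seed is a uniformly random member of the cluster, and it lowers the
  conditional variance of \<open>v \<in> C\<close> by at least \<open>(\<Sum>\<^sub>u |cov(u, v)| / s)\<^sup>2\<close>. As the variance starts below
  \<open>1/4\<close>, a random one among \<open>r - 2\<close> steps has small \<open>\<Sum>\<^sub>u |cov(u, v)| / s\<close>. This sum vanishes unless \<open>v\<close> is
  undecided given the first seed \<open>a\<close>, that is, unless \<open>av\<close> is admissible; and
  \<open>w u v \<le> w u a + w a v\<close> charges the weight of every pair to pairs through \<open>a\<close>. The probability
  \<open>y\<^sub>a\<^sup>s / s\<close> of the first seed cancels the factor \<open>s\<close>. The admissible weight is controlled by the total
  mass of \<open>\<Gamma>\<close>, which equals \<open>\<Sum>d(K) \<le> 2 obj(\<K>)\<close> since \<open>Q\<close> is stochastic with stationary measure \<open>d\<close>.\<close>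

section \<open>Seed walks and conditional covariances\<close>

text \<open>Not an average: each step sums over \<open>V\<close> and divides by \<open>s\<close>.
  The seed walk moves from \<open>U\<close> to \<open>insert a U\<close> with probability
  \<open>y (insert a U) / (s * y U)\<close>; along a path the values of \<open>y\<close> telescope,
  so \<open>y U\<close> times an expectation becomes the \<open>walk_mean\<close> of the integrand
  multiplied by \<open>y\<close>.\<close>

primrec walk_mean ::
  "'a set \<Rightarrow> real \<Rightarrow> nat \<Rightarrow> 'a set \<Rightarrow> ('a set \<Rightarrow> real) \<Rightarrow> real" where
  "walk_mean V s 0 U g = g U"
| "walk_mean V s (Suc t) U g = (\<Sum>a\<in>V. walk_mean V s t (insert a U) g) / s"

lemma walk_mean_mono:
  assumes "\<And>W. U \<subseteq> W \<Longrightarrow> W \<subseteq> V \<Longrightarrow> card W \<le> card U + t \<Longrightarrow> g W \<le> h W" "U \<subseteq> V" "s \<ge> 0"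
  shows "walk_mean V s t U g \<le> walk_mean V s t U h"
  using assms
proof (induction t arbitrary: U)
  case (Suc t)
  have "walk_mean V s t (insert a U) g \<le> walk_mean V s t (insert a U) h" if "a \<in> V" for a
  proof (rule Suc.IH)
    fix W assume W: "insert a U \<subseteq> W" "W \<subseteq> V" "card W \<le> card (insert a U) + t"
    show "g W \<le> h W"
      using W card_insert_le_m1[of "Suc (card U)" U a] by (intro Suc.prems(1)) auto
  qed (use that Suc.prems in auto)
  then show ?case
    using Suc.prems by (auto intro!: divide_right_mono sum_mono)
qed auto

lemma walk_mean_add:
  "walk_mean V s t U (\<lambda>W. g W + h W) = walk_mean V s t U g + walk_mean V s t U h"
  by (induction t arbitrary: U) (auto simp: sum.distrib add_divide_distrib)

lemma walk_mean_cmult: "walk_mean V s t U (\<lambda>W. c * g W) = c * walk_mean V s t U g"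
  by (induction t arbitrary: U) (auto simp: sum_distrib_left)

lemma walk_mean_diff:
  "walk_mean V s t U (\<lambda>W. g W - h W) = walk_mean V s t U g - walk_mean V s t U h"
  using walk_mean_add[of V s t U g "\<lambda>W. (-1) * h W"] walk_mean_cmult[of V s t U "-1" h] by simp

lemma walk_mean_zero: "walk_mean V s t U (\<lambda>W. 0) = 0"
  by (induction t arbitrary: U) auto

lemma walk_mean_sum:
  "finite I \<Longrightarrow> walk_mean V s t U (\<lambda>W. \<Sum>i\<in>I. g i W) = (\<Sum>i\<in>I. walk_mean V s t U (g i))"
  by (induction I rule: finite_induct) (auto simp: walk_mean_add walk_mean_zero)

text \<open>The recursion peels off the first seed; telescoping the energies requires peeling off
  the last one.\<close>

lemma walk_mean_Suc_end:
  "walk_mean V s (Suc t) U g = walk_mean V s t U (\<lambda>W. (\<Sum>a\<in>V. g (insert a W)) / s)"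
proof (induction t arbitrary: U)
  case (Suc t)
  show ?case
    by (subst walk_mean.simps(2)) (simp only: Suc, simp)
qed auto

lemma walk_mean_abs_le:
  assumes "s \<ge> 0" "U \<subseteq> V"
  shows "\<bar>walk_mean V s t U g\<bar> \<le> walk_mean V s t U (\<lambda>W. \<bar>g W\<bar>)"
proof -
  have "walk_mean V s t U g \<le> walk_mean V s t U (\<lambda>W. \<bar>g W\<bar>)"
    "walk_mean V s t U (\<lambda>W. (-1) * \<bar>g W\<bar>) \<le> walk_mean V s t U g"
    using assms by (intro walk_mean_mono; simp)+
  then show ?thesis unfolding walk_mean_cmult by linarith
qed

text \<open>One size class \<open>y\<^sup>s\<close> of an LP solution, seen as an unnormalised pseudodistribution over clusters of
  size \<open>s\<close>.\<close>

locale pseudo_cluster =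
  fixes V :: "'a set" and r :: nat and s :: real and y :: "'a set \<Rightarrow> real"
  assumes finV: "finite V" and s_pos: "s > 0"
    and degree: "\<lbrakk>S \<subseteq> V; card S \<le> r - 1\<rbrakk> \<Longrightarrow> (\<Sum>u\<in>V. y (insert u S)) = s * y S"
    and nonneg: "\<lbrakk>S \<subseteq> V; card S \<le> r\<rbrakk> \<Longrightarrow> y S \<ge> 0"
    and mono: "\<lbrakk>S \<subseteq> V; v \<in> V; card (insert v S) \<le> r\<rbrakk> \<Longrightarrow> y (insert v S) \<le> y S"
    and supermod: "\<lbrakk>S \<subseteq> V; u \<in> V; v \<in> V; card (insert u (insert v S)) \<le> r\<rbrakk> \<Longrightarrow>
      y (insert u S) + y (insert v S) \<le> y S + y (insert u (insert v S))"
begin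

section \<open>Monotonicity and the martingale property under growing seed sets\<close>

lemma antimono:
  assumes "S \<subseteq> T" "T \<subseteq> V" "card T \<le> r"
  shows "y T \<le> y S"
proof -
  have "finite T" using assms finV finite_subset by auto
  have "y (S \<union> X) \<le> y S" if "X \<subseteq> T" for X
    using finite_subset[OF that \<open>finite T\<close>] that
  proof (induction X rule: finite_induct)
    case (insert a F)
    have "card (insert a (S \<union> F)) \<le> card T"
      using insert assms \<open>finite T\<close> by (intro card_mono) auto
    then have "y (insert a (S \<union> F)) \<le> y (S \<union> F)"
      using insert assms by (intro mono) auto
    then show ?case using insert by auto
  qed simp
  from this[of T] assms show ?thesis by (simp add: Un_absorb1)
qed

text \<open>The gap is the pseudo-mass of clusters that contain the conditioning set and
  \<open>u\<close> but miss \<open>v\<close>, so it can only shrink as that set grows.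
  \<open>supermod\<close> is the case of one new element; the induction adds the elements of
  \<open>T\<close> one by one.\<close>

lemma gap_antimono:
  assumes "S \<subseteq> T" "insert u (insert v T) \<subseteq> V" "card T + 2 \<le> r"
  shows "y (insert u T) - y (insert u (insert v T)) \<le> y (insert u S) - y (insert u (insert v S))"
proof -
  have fT: "finite T" using assms finV finite_subset by auto
  have "y (insert u (S \<union> X)) - y (insert u (insert v (S \<union> X)))
    \<le> y (insert u S) - y (insert u (insert v S))" if "X \<subseteq> T" for X
    using finite_subset[OF that fT] that
  proof (induction X rule: finite_induct)
    case (insert a F)
    have "card (insert a (S \<union> F)) \<le> card T"
      using insert assms fT by (intro card_mono) auto
    moreover have "card (insert a (insert v (insert u (S \<union> F)))) \<le> card (insert a (S \<union> F)) + 2"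
      using card_insert_le_m1[of "Suc (card (insert a (S \<union> F)))" "insert a (S \<union> F)" u]
        card_insert_le_m1[of "Suc (Suc (card (insert a (S \<union> F))))" "insert u (insert a (S \<union> F))" v]
      by (simp add: insert_commute)
    ultimately have "y (insert a (insert u (S \<union> F))) + y (insert v (insert u (S \<union> F)))
      \<le> y (insert u (S \<union> F)) + y (insert a (insert v (insert u (S \<union> F))))"
      using insert assms by (intro supermod) auto
    then show ?case using insert by (simp add: insert_commute)
  qed simp
  from this[of T] assms show ?thesis by (simp add: Un_absorb1)
qed

text \<open>The degree constraint sums the values after one more seed to \<open>s\<close> times the
  current value, and the division by \<open>s\<close> cancels it. The cardinality bound keeps every
  set met at a rank where this constraint is available.\<close>

lemma walk_mean_martingale:
  assumes "U \<subseteq> V" "S \<subseteq> V" "card U + t + card S \<le> r"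
  shows "walk_mean V s t U (\<lambda>W. y (W \<union> S)) = y (U \<union> S)"
  using assms
proof (induction t arbitrary: U)
  case (Suc t)
  have "walk_mean V s t (insert a U) (\<lambda>W. y (W \<union> S)) = y (insert a (U \<union> S))" if "a \<in> V" for a
    using that Suc.prems card_insert_le_m1[of "Suc (card U)" U a]
    by (subst Suc.IH) auto
  moreover have "(\<Sum>a\<in>V. y (insert a (U \<union> S))) = s * y (U \<union> S)"
    using Suc.prems card_Un_le[of U S] by (intro degree) auto
  ultimately show ?case using s_pos by simp
qed auto

text \<open>Absolute covariance, given that \<open>U\<close> lies in the cluster, of the events that
  \<open>u\<close> and \<open>v\<close> do, multiplied by \<open>y U\<close>. This factor is the
  weight that \<open>walk_mean\<close> expects.\<close>

definition cov :: "'a set \<Rightarrow> 'a \<Rightarrow> 'a \<Rightarrow> real" where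
  "cov U u v = \<bar>y (insert u U) * y (insert v U) / y U - y (insert u (insert v U))\<bar>"

text \<open>Second moment of the martingale: \<open>y U\<close> times the square of the conditional
  probability of \<open>v\<close>. One more seed raises its mean by a conditional variance.\<close>

definition energy :: "'a \<Rightarrow> 'a set \<Rightarrow> real" where
  "energy v U = (y (insert v U))\<^sup>2 / y U"

lemma card_insert_bound: "0 < n \<Longrightarrow> card U + n \<le> r \<Longrightarrow> card (insert u U) + (n - 1) \<le> r"
  using card_insert_le_m1[of "Suc (card U)" U u] by auto

lemma cov_commute: "cov U u v = cov U v u"
  by (simp add: cov_def insert_commute mult.commute)

text \<open>Adding \<open>u\<close> changes the conditional probability of \<open>v\<close> by
  \<open>x = q u / p u - p v / Y\<close>, and the covariance is \<open>p u\<close> times the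
  absolute value of \<open>x\<close>. The energy gained in one step is the sum of the squares of
  \<open>x\<close> with weights \<open>p u / s\<close>, so a large total covariance forces a large
  gain.\<close>

lemma sum_cov_le:
  assumes U: "U \<subseteq> V" "card U + 2 \<le> r" and v: "v \<in> V" and lam: "lam > 0"
  shows "(\<Sum>u\<in>V. cov U u v)
    \<le> s * (lam * ((\<Sum>u\<in>V. energy v (insert u U)) / s - energy v U) + y U / (4 * lam))"
proof (cases "y U = 0")
  case True
  have z: "y (insert u U) = 0" "y (insert v U) = 0" "y (insert u (insert v U)) = 0"
     if "u \<in> V" for u
  proof -
    have c: "card (insert u U) \<le> r" "card (insert v U) \<le> r" "card (insert u (insert v U)) \<le> r"
      using U card_insert_bound[of 2 U u] card_insert_bound[of 2 U v]
        card_insert_bound[of 1 "insert v U" u]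
      by auto
    show "y (insert u U) = 0" "y (insert v U) = 0" "y (insert u (insert v U)) = 0"
      using antimono[of U "insert u U"] antimono[of U "insert v U"]
         antimono[of U "insert u (insert v U)"]  nonneg[of "insert u U"] nonneg[of "insert v U"]
        nonneg[of "insert u (insert v U)"] c U v that True by auto
  qed
  then show ?thesis using True v by (simp add: cov_def energy_def)
next
  case False
  define Y where "Y = y U"
  define p where "p u = y (insert u U)" for u
  define q where "q u = y (insert u (insert v U))" for u
  have Y: "Y > 0" using False nonneg[of U] U by (simp add: Y_def)
  have c: "card (insert u U) + 1 \<le> r" "card (insert u (insert v U)) \<le> r" for u
    using U card_insert_bound[of 2 U u] card_insert_bound[of 2 U v]
        card_insert_bound[of 1 "insert v U" u] by auto
  have p0: "p u \<ge> 0" if "u \<in> V" for u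
    using that U c(1)[of u] by (auto simp: p_def intro!: nonneg)
  have q0: "q u \<ge> 0" "q u \<le> p u" if "u \<in> V" for u
    using that U v c[of u] antimono[of "insert u U" "insert u (insert v U)"]
    by (auto simp: q_def p_def intro!: nonneg)
  have sp: "(\<Sum>u\<in>V. p u) = s * Y"
    unfolding p_def Y_def using U by (intro degree) auto
  have sq: "(\<Sum>u\<in>V. q u) = s * p v"
    unfolding q_def p_def using U v c(1)[of v] by (intro degree) auto
  have "cov U u v \<le> lam * ((q u)\<^sup>2 / p u) - 2 * lam * p v / Y * q u + lam * (p v)\<^sup>2 / Y\<^sup>2 * p u
      + p u / (4 * lam)" if "u \<in> V" for u
  proof (cases "p u = 0")
    case True
    then show ?thesis using q0[OF that] by (simp add: cov_def p_def q_def)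
  next
    case False
    then have pu: "p u > 0" using p0[OF that] by simp
    define x where "x = q u / p u - p v / Y"
    \<comment> \<open>Arithmetic-geometric means in place of Cauchy-Schwarz: the bound stays linear
      in the energy, so it can be averaged over the walk, and \<open>lam\<close> is chosen only at
      the end.\<close>
    have "\<bar>x\<bar> \<le> lam * x\<^sup>2 + 1 / (4 * lam)"
    proof -
      have "0 \<le> (2 * lam * \<bar>x\<bar> - 1)\<^sup>2 / (4 * lam)" using lam by simp
      also have "\<dots> = lam * x\<^sup>2 + 1 / (4 * lam) - \<bar>x\<bar>"
        using lam by (simp add: field_simps power2_eq_square)
      finally show ?thesis by simp
    qed
    then have "p u * \<bar>x\<bar> \<le> p u * (lam * x\<^sup>2 + 1 / (4 * lam))"
      using pu by (intro mult_left_mono) auto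
    moreover have "cov U u v = p u * \<bar>x\<bar>"
    proof -
      have "cov U u v = \<bar>p u * (- x)\<bar>"
        using pu Y unfolding cov_def x_def
        by (intro arg_cong[where f=abs]) (simp add: p_def q_def Y_def field_simps)
      then show ?thesis using pu by (simp add: abs_mult)
    qed
    moreover have "p u * (lam * x\<^sup>2 + 1 / (4 * lam)) = lam * ((q u)\<^sup>2 / p u) - 2 * lam * p v / Y * q u + lam * (p v)\<^sup>2 / Y\<^sup>2 * p u
      + p u / (4 * lam)"
      using pu Y lam unfolding x_def by (simp add: field_simps power2_eq_square)
    ultimately show ?thesis by simp
  qed
  then have "(\<Sum>u\<in>V. cov U u v) \<le> (\<Sum>u\<in>V. lam * ((q u)\<^sup>2 / p u) - 2 * lam * p v / Y * q u + lam * (p v)\<^sup>2 / Y\<^sup>2 * p u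
      + p u / (4 * lam))"
    by (rule sum_mono)
  also have "\<dots> = lam * (\<Sum>u\<in>V. (q u)\<^sup>2 / p u) - 2 * lam * p v / Y * (\<Sum>u\<in>V. q u)
      + lam * (p v)\<^sup>2 / Y\<^sup>2 * (\<Sum>u\<in>V. p u) + (\<Sum>u\<in>V. p u) / (4 * lam)"
    by (simp only: sum.distrib sum_subtractf sum_distrib_left sum_divide_distrib)
  \<comment> \<open>The degree constraints evaluate both linear sums, and the two terms in
    \<open>p v\<close> collapse to minus the old energy.\<close>
  also have "\<dots> = lam * (\<Sum>u\<in>V. (q u)\<^sup>2 / p u) - lam * s * (p v)\<^sup>2 / Y + s * Y / (4 * lam)"
    using Y unfolding sp sq by (simp add: field_simps power2_eq_square)
  also have "\<dots> = s * (lam * ((\<Sum>u\<in>V. (q u)\<^sup>2 / p u) / s - (p v)\<^sup>2 / Y) + Y / (4 * lam))"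
    using s_pos by (simp add: field_simps)
  finally show ?thesis
    by (simp add: energy_def p_def q_def Y_def insert_commute)
qed

lemma energy_le:
  assumes "U \<subseteq> V" "v \<in> V" "card U + 1 \<le> r"
  shows "energy v U \<le> y (insert v U)"
proof (cases "y U = 0")
  case True
  then show ?thesis
    using assms card_insert_bound[of 1 U v] nonneg[of "insert v U"] by (auto simp: energy_def)
next
  case False
  have c: "card (insert v U) \<le> r" using assms card_insert_bound[of 1 U v] by auto
  have "y U > 0" using False nonneg[of U] assms by auto
  moreover have "y (insert v U) * y (insert v U) \<le> y (insert v U) * y U"
    using assms c by (intro mult_left_mono mono nonneg) auto
  ultimately show ?thesis
    by (simp add: energy_def power2_eq_square divide_le_eq)
qed

text \<open>The energies telescope along the walk, and their total increase is at most the variance of a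
  Bernoulli variable.\<close>

lemma sum_walk_mean_cov_le:
  assumes a: "a \<in> V" and v: "v \<in> V" and m: "m + 2 \<le> r" and lam: "lam > 0"
  shows "(\<Sum>t<m. walk_mean V s t {a} (\<lambda>U. \<Sum>u\<in>V. cov U u v))
    \<le> s * y {a} * (lam / 4 + m / (4 * lam))"
proof -
  have "walk_mean V s t {a} (\<lambda>U. \<Sum>u\<in>V. cov U u v)
     \<le> s * (lam * (walk_mean V s (Suc t) {a} (energy v) - walk_mean V s t {a} (energy v))
           + y {a} / (4 * lam))" if "t < m" for t
  proof -
    have "walk_mean V s t {a} (\<lambda>U. \<Sum>u\<in>V. cov U u v) \<le> walk_mean V s t {a}
      (\<lambda>U. s * (lam * ((\<Sum>u\<in>V. energy v (insert u U)) / s - energy v U) + 1 / (4 * lam) * y U))"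
      using a v m lam that s_pos
      by (intro walk_mean_mono order.trans[OF sum_cov_le]) (auto simp: field_simps)
    also have "\<dots> = s * (lam * (walk_mean V s (Suc t) {a} (energy v) - walk_mean V s t {a} (energy v))
           + 1 / (4 * lam) * walk_mean V s t {a} y)"
      unfolding walk_mean_Suc_end
      by (simp only: walk_mean_cmult walk_mean_add walk_mean_diff)
    also have "walk_mean V s t {a} y = y {a}"
      using walk_mean_martingale[of "{a}" "{}" t] a m that by simp
    finally show ?thesis by simp
  qed
  then have "(\<Sum>t<m. walk_mean V s t {a} (\<lambda>U. \<Sum>u\<in>V. cov U u v)) \<le>
    (\<Sum>t<m. s * (lam * (walk_mean V s (Suc t) {a} (energy v) - walk_mean V s t {a} (energy v))
           + y {a} / (4 * lam)))"
    by (intro sum_mono) auto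
  also have "\<dots> = s * (lam * (walk_mean V s m {a} (energy v) - energy v {a}) + m * y {a} / (4 * lam))"
  proof -
    have tel: "(\<Sum>t<m. walk_mean V s (Suc t) {a} (energy v) - walk_mean V s t {a} (energy v))
      = walk_mean V s m {a} (energy v) - energy v {a}"
      by (subst sum_lessThan_telescope) simp
    show ?thesis
      unfolding sum_distrib_left[symmetric] sum.distrib tel by simp
  qed
  also have "\<dots> \<le> s * (lam * (y {a} / 4) + m * y {a} / (4 * lam))"
  proof -
    \<comment> \<open>A conditional probability is at least its square, so the final energy is
      bounded by a martingale whose mean is known.\<close>
    have "walk_mean V s m {a} (energy v) \<le> walk_mean V s m {a} (\<lambda>U. y (U \<union> {v}))"
      using a v m s_pos by (intro walk_mean_mono) (auto intro!: energy_le)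
    also have "\<dots> = y ({a} \<union> {v})"
      using a v m by (intro walk_mean_martingale) auto
    finally have "walk_mean V s m {a} (energy v) \<le> y {a, v}" by (simp add: insert_commute)
    \<comment> \<open>With \<open>p\<close> the conditional probability of \<open>v\<close> given
      \<open>a\<close>, the left side is \<open>y {a}\<close> times \<open>p - p * p\<close>;
      completing the square gives the factor 1/4.\<close>
    moreover have "y {a, v} - energy v {a} \<le> y {a} / 4"
    proof -
      have nn: "y {a} \<ge> 0" "y {v, a} \<ge> 0" "y {v, a} \<le> y {a}"
        using a v m nonneg[of "{a}"] nonneg[of "{v,a}"] mono[of "{a}" v]
        by (auto simp: card_insert_if)
      show ?thesis
      proof (cases "y {a} = 0")
        case False
        then have pos: "y {a} > 0" using nn by simp
        have "0 \<le> (y {a, v} - y {a} / 2)\<^sup>2 / y {a}" using pos by simp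
        also have "\<dots> = y {a} / 4 - (y {a, v} - energy v {a})"
          using pos by (simp add: energy_def field_simps power2_eq_square insert_commute)
        finally show ?thesis by simp
      qed (use nn in \<open>auto simp: energy_def insert_commute\<close>)
    qed
    ultimately show ?thesis
      using s_pos lam by (intro mult_left_mono add_mono) auto
  qed
  also have "\<dots> = s * y {a} * (lam / 4 + m / (4 * lam))" by (simp add: field_simps)
  finally show ?thesis .
qed

text \<open>Knowing \<open>a\<close> already decides \<open>v\<close>, hence so does every larger
  set: the conditional probability of \<open>v\<close> stays 0 or 1, and such an event is
  uncorrelated with every other.\<close>

lemma cov_eq_0:
  assumes "a \<in> U" "insert u (insert v U) \<subseteq> V" "card U + 2 \<le> r"
    and "y {a, v} = 0 \<or> y {a, v} = y {a}"
  shows "cov U u v = 0"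
proof -
  have fU: "finite U" using assms finV finite_subset by auto
  have c: "card (insert v U) + 1 \<le> r" "card (insert u U) + 1 \<le> r" "card (insert u (insert v U)) \<le> r"
    using assms card_insert_bound[of 2 U u] card_insert_bound[of 2 U v]
        card_insert_bound[of 1 "insert v U" u] by auto
  from assms(4) show ?thesis
  proof
    assume z: "y {a, v} = 0"
    have "y (insert v U) \<le> y {a,v}" "y (insert u (insert v U)) \<le> y {a,v}"
      using assms c by (intro antimono; auto)+
    moreover have "0 \<le> y (insert v U)" "0 \<le> y (insert u (insert v U))"
      using assms c by (intro nonneg; auto)+
    ultimately show ?thesis using z by (simp add: cov_def)
  next
    assume e: "y {a, v} = y {a}"
    \<comment> \<open>Equality at \<open>{a}\<close> is a zero gap at the empty set, and gaps only
      shrink. Taking \<open>a\<close> out of \<open>W\<close> before applying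
      \<open>gap_antimono\<close> keeps the rank requirement at \<open>card W + 1 \<le> r\<close>,
      which \<open>insert u U\<close> still meets.\<close>
    have *: "y W \<le> y (insert v W)" if "a \<in> W" "W \<subseteq> V" "card W + 1 \<le> r" for W
    proof -
      have "card (W - {a}) + 2 \<le> r"
        using that card_Suc_Diff1[OF finite_subset[OF that(2) finV] that(1)] by linarith
      then have "y (insert a (W - {a})) - y (insert a (insert v (W - {a}))) \<le> y {a} - y {a, v}"
        using gap_antimono[of "{}" "W - {a}" a v] that assms by auto
      moreover have "insert a (insert v (W - {a})) = insert v W" "insert a (W - {a}) = W"
        using that by auto
      ultimately show ?thesis using e by simp
    qed
    have "y (insert v U) = y U"
      using *[of U] antimono[of U "insert v U"] assms c by auto
    moreover have "y (insert u (insert v U)) = y (insert u U)"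
      using *[of "insert u U"] antimono[of "insert u U" "insert u (insert v U)"] assms c
      by (auto simp: insert_commute)
    moreover have "y (insert u U) = 0" if "y U = 0"
      using that assms c mono[of U u] nonneg[of "insert u U"] by auto
    ultimately show ?thesis by (cases "y U = 0") (auto simp: cov_def)
  qed
qed

end

section \<open>The law of the sampled cluster\<close>

lemma prob_bind_pmf:
  "measure_pmf.prob (bind_pmf M f) A = measure_pmf.expectation M (\<lambda>x. measure_pmf.prob (f x) A)"
  unfolding measure_pmf_bind
  by (rule measure_pmf.measure_bind[where N = "count_space UNIV"]) (auto simp: measure_pmf_in_subprob_algebra)

lemma expectation_embed_pmf:
  fixes f g :: "'b \<Rightarrow> real"
  assumes "finite S" "\<And>x. x \<in> S \<Longrightarrow> f x \<ge> 0" "sum f S = 1"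
  shows "measure_pmf.expectation (embed_pmf (\<lambda>x. if x \<in> S then f x else 0)) g = (\<Sum>x\<in>S. f x * g x)"
proof -
  let ?f = "\<lambda>x. if x \<in> S then f x else 0"
  have "(\<integral>\<^sup>+ x. ennreal (?f x) \<partial>count_space UNIV) = (\<Sum>x\<in>S. ennreal (?f x))"
    using assms by (intro nn_integral_count_space') auto
  also have "\<dots> = ennreal (\<Sum>x\<in>S. f x)"
    using assms by (subst sum_ennreal) auto
  finally have pmf: "pmf (embed_pmf ?f) x = ?f x" for x
    using assms by (intro pmf_embed_pmf) auto
  have "measure_pmf.expectation (embed_pmf ?f) g = (\<Sum>x\<in>S. g x * pmf (embed_pmf ?f) x)"
    using assms pmf by (intro integral_measure_pmf_real) (auto simp: set_pmf_iff split: if_splits)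
  then show ?thesis using pmf by (simp add: mult.commute)
qed

text \<open>The product runs over the set \<open>{K, L}\<close>: vertices of one atom share a single
  coin and contribute one factor, vertices of distinct atoms use independent coins.\<close>

lemma prob_pick_atoms:
  assumes part: "partition_on V \<K>" "finite \<K>" and KL: "K \<in> \<K>" "L \<in> \<K>" "u \<in> K" "v \<in> L"
    and K: "0 \<le> y s (U \<union> {rep K}) / y s U" "y s (U \<union> {rep K}) / y s U \<le> 1"
    and L: "0 \<le> y s (U \<union> {rep L}) / y s U" "y s (U \<union> {rep L}) / y s U \<le> 1"
  shows "measure_pmf.prob (pick_atoms \<K> rep y s U) {C. u \<in> C \<and> v \<in> C} =
    (\<Prod>M\<in>{K, L}. y s (U \<union> {rep M}) / y s U)"
proof -
  let ?q = "\<lambda>K. y s (U \<union> {rep K}) / y s U"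
  let ?B = "\<lambda>M. if M \<in> {K, L} then {True} else UNIV"
  have uniq: "M = N" if "M \<in> \<K>" "N \<in> \<K>" "x \<in> M" "x \<in> N" for M N x
    using partition_onD2[OF part(1)] that by (auto simp: disjoint_def)
  have "u \<in> \<Union>{K \<in> \<K>. b K} \<longleftrightarrow> b K" "v \<in> \<Union>{K \<in> \<K>. b K} \<longleftrightarrow> b L" for b
    using uniq KL by blast+
  then have "(\<lambda>b. \<Union>{K \<in> \<K>. b K}) -` {C. u \<in> C \<and> v \<in> C} = {b. b K \<and> b L}"
    by (simp only: vimage_Collect_eq)
  also have "\<dots> = Pi \<K> ?B"
    using KL by (auto simp: Pi_def split: if_splits)
  finally have "measure_pmf.prob (pick_atoms \<K> rep y s U) {C. u \<in> C \<and> v \<in> C} =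
     measure_pmf.prob (Pi_pmf \<K> False (\<lambda>K. bernoulli_pmf (?q K))) (Pi \<K> ?B)"
    by (simp add: pick_atoms_def)
  also have "\<dots> = (\<Prod>M\<in>\<K>. measure_pmf.prob (bernoulli_pmf (?q M)) (?B M))"
    by (rule measure_Pi_pmf_Pi) fact
  also have "\<dots> = (\<Prod>M\<in>\<K>. if M \<in> {K, L} then ?q M else 1)"
    using K L by (intro prod.cong) (auto simp: measure_pmf_single)
  also have "\<dots> = (\<Prod>M\<in>{K, L}. ?q M)"
    using KL part(2) by (intro prod.mono_neutral_cong_right) auto
  finally show ?thesis .
qed

context pseudo_cluster
begin

text \<open>Multiplying the first transition probability by \<open>y U\<close> leaves
  \<open>y (insert a U) / s\<close>, and \<open>y (insert a U)\<close> is exactly the factor that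
  the induction hypothesis asks for.\<close>

lemma prob_pick_seeds_bind:
  assumes "s = real k" "U \<subseteq> V" "card U + t \<le> r" "yy k = y"
  shows "y U * measure_pmf.prob (bind_pmf (pick_seeds V yy k t U) h) A
    = walk_mean V s t U (\<lambda>W. y W * measure_pmf.prob (h W) A)"
  using assms
proof (induction t arbitrary: U)
  case 0
  then show ?case by (simp add: bind_return_pmf)
next
  case (Suc t)
  let ?p = "\<lambda>a. measure_pmf.prob (bind_pmf (pick_seeds V yy k t (insert a U)) h) A"
  have c: "card (insert a U) + t \<le> r" for a
    using Suc.prems card_insert_le_m1[of "Suc (card U)" U a] by auto
  have "walk_mean V s (Suc t) U (\<lambda>W. y W * measure_pmf.prob (h W) A)
    = (\<Sum>a\<in>V. y (insert a U) * ?p a) / s"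
    using Suc.IH Suc.prems c by simp
  also have "\<dots> = y U * measure_pmf.prob (bind_pmf (pick_seeds V yy k (Suc t) U) h) A"
  proof (cases "y U = 0")
    \<comment> \<open>The walk would be conditioned on a null event, where
      \<open>pick_vertex\<close> carries no meaning; monotonicity makes both sides zero.\<close>
    case True
    have "y (insert a U) = 0" if "a \<in> V" for a
      using that True Suc.prems c[of a] mono[of U a] nonneg[of "insert a U"] by auto
    then show ?thesis using True by simp
  next
    case False
    then have pos: "y U > 0" using nonneg[of U] Suc.prems by auto
    have deg: "(\<Sum>u\<in>V. y (insert u U)) = s * y U" using Suc.prems by (intro degree) auto
    have "measure_pmf.prob (bind_pmf (pick_seeds V yy k (Suc t) U) h) A
      = measure_pmf.expectation (pick_vertex V yy k U) ?p"
      by (simp add: bind_assoc_pmf prob_bind_pmf[of "pick_vertex V yy k U"])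
    also have "\<dots> = (\<Sum>a\<in>V. y (insert a U) / (s * y U) * ?p a)"
      unfolding pick_vertex_def
    proof (subst expectation_embed_pmf)
      show "0 \<le> yy k (U \<union> {x}) / (real k * yy k U)" if "x \<in> V" for x
        using that pos s_pos Suc.prems c[of x] nonneg[of "insert x U"] by auto
      show "(\<Sum>x\<in>V. yy k (U \<union> {x}) / (real k * yy k U)) = 1"
        using deg pos s_pos Suc.prems by (simp add: sum_divide_distrib[symmetric])
    qed (use finV Suc.prems in auto)
    finally show ?thesis
      using pos by (simp add: sum_distrib_left sum_divide_distrib field_simps)
  qed
  finally show ?case by simp
qed

end

section \<open>The weight of the admissible pairs\<close>

lemma edge_sum_altdef:
  assumes "finite V" "E \<subseteq> nsets V 2"
  shows "edge_sum E f = (\<Sum>u\<in>V. \<Sum>v\<in>V. if u \<noteq> v \<and> {u, v} \<in> E then f u v else 0) / 2"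
proof -
  have "(\<Sum>u\<in>V. \<Sum>v\<in>V. if u \<noteq> v \<and> {u, v} \<in> E then f u v else 0)
    = (\<Sum>(u, v)\<in>V \<times> V. if u \<noteq> v \<and> {u, v} \<in> E then f u v else 0)"
    by (simp add: sum.cartesian_product)
  also have "\<dots> = (\<Sum>(u, v) \<in> {(u, v). u \<noteq> v \<and> {u, v} \<in> E}. f u v)"
    using assms by (intro sum.mono_neutral_cong_right) (auto simp: subset_iff split: if_splits)
  finally show ?thesis by (simp add: edge_sum_def)
qed

lemma partition_on_UN:
  assumes "partition_on V \<C>" "\<And>C. C \<in> \<C> \<Longrightarrow> partition_on C (F C)"
  shows "partition_on V (\<Union>C\<in>\<C>. F C)"
proof (rule partition_onI)
  have "\<Union> (\<Union>C\<in>\<C>. F C) = (\<Union>C\<in>\<C>. \<Union> (F C))" by auto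
  also have "\<dots> = V"
    using assms by (simp add: partition_on_def)
  finally show "\<Union> (\<Union>C\<in>\<C>. F C) = V" .
  fix p q assume pq: "p \<in> (\<Union>C\<in>\<C>. F C)" "q \<in> (\<Union>C\<in>\<C>. F C)" "p \<noteq> q"
  then obtain C D where CD: "C \<in> \<C>" "D \<in> \<C>" "p \<in> F C" "q \<in> F D" by auto
  then have "p \<subseteq> C" "q \<subseteq> D"
    using assms(2) by (auto simp: partition_on_def)
  moreover have "disjnt p q" if "C = D"
    using assms(2)[OF CD(1)] CD pq that by (auto simp: partition_on_def disjoint_def disjnt_def)
  moreover have "C \<inter> D = {}" if "C \<noteq> D"
    using that CD assms(1) by (auto simp: partition_on_def disjoint_def)
  ultimately show "disjnt p q" by (fastforce simp: disjnt_def)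
qed (use assms in \<open>auto simp: partition_on_def\<close>)

lemma partition_on_atoms_of: "partition_on C (atoms_of Ep w \<beta> C)"
proof -
  have "marked Ep w \<beta> C \<subseteq> C" by (auto simp: marked_def)
  then show ?thesis
    by (auto simp: atoms_of_def Let_def partition_on_def disjoint_def)
qed

lemma partition_on_atoms: "partition_on V \<C> \<Longrightarrow> partition_on V (atoms Ep w \<beta> \<C>)"
  unfolding atoms_def by (intro partition_on_UN partition_on_atoms_of)

text \<open>The last clause says that the unnormalised measure \<open>d\<close> is stationary. All
  clauses survive products and averages, so they pass from \<open>P\<close> to
  \<open>Q\<close>.\<close>

definition stochastic_on :: "'i set \<Rightarrow> ('i \<Rightarrow> real) \<Rightarrow> ('i \<Rightarrow> 'i \<Rightarrow> real) \<Rightarrow> bool" where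
  "stochastic_on I d A \<longleftrightarrow> (\<forall>i\<in>I. \<forall>j\<in>I. A i j \<ge> 0) \<and> (\<forall>i\<in>I. (\<Sum>j\<in>I. A i j) = 1) \<and>
     (\<forall>j\<in>I. (\<Sum>i\<in>I. d i * A i j) = d j)"

lemma stochastic_on_mdiag_1: "finite I \<Longrightarrow> stochastic_on I d (mdiag (\<lambda>_. 1))"
  by (auto simp: stochastic_on_def mdiag_def if_distrib sum.delta cong: if_cong)

lemma stochastic_on_mmul:
  assumes A: "stochastic_on I d A" and B: "stochastic_on I d B"
  shows "stochastic_on I d (mmul I A B)"
  unfolding stochastic_on_def
proof (intro conjI ballI)
  fix i assume i: "i \<in> I"
  have "(\<Sum>j\<in>I. mmul I A B i j) = (\<Sum>k\<in>I. A i k * (\<Sum>j\<in>I. B k j))"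
    unfolding mmul_def sum_distrib_left by (rule sum.swap)
  also have "\<dots> = 1" using A B i by (simp add: stochastic_on_def)
  finally show "(\<Sum>j\<in>I. mmul I A B i j) = 1" .
  have "(\<Sum>k\<in>I. d k * mmul I A B k i) = (\<Sum>k\<in>I. \<Sum>l\<in>I. d k * A k l * B l i)"
    by (simp add: mmul_def sum_distrib_left mult_ac)
  also have "\<dots> = (\<Sum>l\<in>I. (\<Sum>k\<in>I. d k * A k l) * B l i)"
    unfolding sum_distrib_right by (rule sum.swap)
  also have "\<dots> = d i" using A B i by (simp add: stochastic_on_def)
  finally show "(\<Sum>k\<in>I. d k * mmul I A B k i) = d i" .
  fix j assume "j \<in> I"
  then show "0 \<le> mmul I A B i j"
    using A B i unfolding mmul_def by (intro sum_nonneg) (auto simp: stochastic_on_def)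
qed

lemma stochastic_on_mpow:
  "finite I \<Longrightarrow> stochastic_on I d A \<Longrightarrow> stochastic_on I d (mpow I A n)"
  by (induction n) (auto intro: stochastic_on_mdiag_1 stochastic_on_mmul)

lemma stochastic_on_lazy:
  assumes "stochastic_on I d A" "stochastic_on I d B"
  shows "stochastic_on I d (\<lambda>i j. (A i j + B i j) / 2)"
  using assms unfolding stochastic_on_def
  by (auto simp: sum_divide_distrib[symmetric] sum.distrib distrib_left)

lemma mmul_mdiag_left: "finite I \<Longrightarrow> i \<in> I \<Longrightarrow> mmul I (mdiag d) A i j = d i * A i j"
  by (simp add: mmul_def mdiag_def if_distrib[where f="\<lambda>x. x * _"] cong: if_cong)

lemma mmul_mdiag_right: "finite I \<Longrightarrow> j \<in> I \<Longrightarrow> mmul I A (mdiag d) i j = A i j * d j"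
  by (simp add: mmul_def mdiag_def if_distrib[where f="\<lambda>x. _ * x"] cong: if_cong)

section \<open>The random walk on the atoms and the total mass of \<open>Gam\<close>\<close>

locale weighted_partition =
  fixes V :: "'a set" and Ep Em :: "'a set set" and w :: "'a \<Rightarrow> 'a \<Rightarrow> real" and \<K> :: "'a set set"
  assumes inst: "cc_instance V Ep Em w" and part: "partition_on V \<K>"
begin

lemma finite_V: "finite V" and w_sym: "\<lbrakk>u \<in> V; v \<in> V\<rbrakk> \<Longrightarrow> w u v = w v u"
  and w_nonneg: "\<lbrakk>u \<in> V; v \<in> V\<rbrakk> \<Longrightarrow> w u v \<ge> 0"
  and w_tri: "\<lbrakk>u \<in> V; v \<in> V; a \<in> V\<rbrakk> \<Longrightarrow> w u v \<le> w u a + w a v"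
  and pairs: "Ep \<union> Em = nsets V 2"
  using inst unfolding cc_instance_def by blast+

lemma finite_parts: "finite \<K>" and part_subset: "K \<in> \<K> \<Longrightarrow> K \<subseteq> V"
  and part_unique: "\<lbrakk>K \<in> \<K>; L \<in> \<K>; x \<in> K; x \<in> L\<rbrakk> \<Longrightarrow> K = L"
  using finite_elements[OF finite_V part] part by (auto simp: partition_on_def disjoint_def)

lemma wpos_nonneg: "\<lbrakk>K \<in> \<K>; L \<in> \<K>\<rbrakk> \<Longrightarrow> wpos Ep w K L \<ge> 0"
  unfolding wpos_def using part_subset w_nonneg by (intro sum_nonneg) (auto simp: subset_iff)

lemma wpos_commute: "\<lbrakk>K \<in> \<K>; L \<in> \<K>\<rbrakk> \<Longrightarrow> wpos Ep w K L = wpos Ep w L K"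
  unfolding wpos_def using part_subset w_sym
  by (subst sum.swap) (intro sum.cong refl, auto simp: subset_iff insert_commute)

lemma wsum_commute: "\<lbrakk>K \<in> \<K>; L \<in> \<K>\<rbrakk> \<Longrightarrow> wsum w K L = wsum w L K"
  unfolding wsum_def using part_subset w_sym
  by (subst sum.swap) (intro sum.cong refl, auto simp: subset_iff)

lemma adeg_nonneg: "K \<in> \<K> \<Longrightarrow> adeg Ep w \<K> K \<ge> 0"
  unfolding adeg_def by (intro sum_nonneg wpos_nonneg) auto

lemma finite_atoms_plus: "finite (atoms_plus Ep w \<K>)"
  using finite_parts by (auto simp: atoms_plus_def)

text \<open>An atom outside \<open>atoms_plus\<close> has degree zero, hence no positive weight to
  any other atom, so restricting the walk loses no weight.\<close>

lemma sum_wpos_atoms_plus: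
  assumes "K \<in> \<K>"
  shows "(\<Sum>L\<in>atoms_plus Ep w \<K>. if K = L then 0 else wpos Ep w K L) = adeg Ep w \<K> K"
proof -
  have "wpos Ep w K L = 0" if "L \<in> \<K> - {K}" "L \<notin> atoms_plus Ep w \<K>" for L
  proof -
    have "adeg Ep w \<K> L = 0"
      using that adeg_nonneg[of L] by (auto simp: atoms_plus_def)
    then have "wpos Ep w L K = 0"
      using that assms finite_parts wpos_nonneg unfolding adeg_def
      by (subst (asm) sum_nonneg_eq_0_iff) auto
    then show ?thesis using that assms wpos_commute[of K L] by auto
  qed
  then show ?thesis
    unfolding adeg_def using finite_parts
    by (intro sum.mono_neutral_cong) (auto simp: atoms_plus_def finite_subset)
qed

text \<open>The walk is reversible: degree times transition probability is the symmetric weight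
  \<open>wpos\<close>, so the degrees form a stationary measure.\<close>

lemma stochastic_on_walkP:
  "stochastic_on (atoms_plus Ep w \<K>) (adeg Ep w \<K>) (walkP Ep w \<K>)"
  unfolding stochastic_on_def
proof (intro conjI ballI)
  fix K assume K: "K \<in> atoms_plus Ep w \<K>"
  then have K': "K \<in> \<K>" "adeg Ep w \<K> K > 0" by (auto simp: atoms_plus_def)
  have "(\<Sum>L\<in>atoms_plus Ep w \<K>. walkP Ep w \<K> K L)
    = (\<Sum>L\<in>atoms_plus Ep w \<K>. if K = L then 0 else wpos Ep w K L) / adeg Ep w \<K> K"
    unfolding sum_divide_distrib by (intro sum.cong) (auto simp: walkP_def)
  then show "(\<Sum>L\<in>atoms_plus Ep w \<K>. walkP Ep w \<K> K L) = 1"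
    using K' by (simp add: sum_wpos_atoms_plus)
  have "(\<Sum>L\<in>atoms_plus Ep w \<K>. adeg Ep w \<K> L * walkP Ep w \<K> L K)
    = (\<Sum>L\<in>atoms_plus Ep w \<K>. if K = L then 0 else wpos Ep w K L)"
    using K' by (intro sum.cong) (auto simp: walkP_def atoms_plus_def wpos_commute)
  then show "(\<Sum>L\<in>atoms_plus Ep w \<K>. adeg Ep w \<K> L * walkP Ep w \<K> L K) = adeg Ep w \<K> K"
    using K' by (simp add: sum_wpos_atoms_plus)
  fix L assume "L \<in> atoms_plus Ep w \<K>"
  then show "0 \<le> walkP Ep w \<K> K L"
    using K' wpos_nonneg[of K L] by (auto simp: walkP_def atoms_plus_def)
qed

lemma stochastic_on_walkQ:
  "stochastic_on (atoms_plus Ep w \<K>) (adeg Ep w \<K>) (walkQ Ep w \<K>)"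
  unfolding walkQ_def Let_def
  by (intro stochastic_on_mmul stochastic_on_walkP stochastic_on_mpow stochastic_on_lazy
      stochastic_on_mdiag_1 finite_atoms_plus)

lemma Gam_eq:
  assumes "K \<in> atoms_plus Ep w \<K>" "L \<in> atoms_plus Ep w \<K>"
  shows "Gam Ep w \<K> K L = adeg Ep w \<K> K * (\<Sum>M\<in>atoms_plus Ep w \<K>.
    walkQ Ep w \<K> K M * (1 / adeg Ep w \<K> M * (walkQ Ep w \<K> L M * adeg Ep w \<K> L)))"
  using assms unfolding Gam_def Let_def
  by (simp add: mmul_mdiag_left[OF finite_atoms_plus])
    (simp add: mmul_def[of _ "walkQ Ep w \<K>"] mmul_mdiag_left[OF finite_atoms_plus]
      mmul_mdiag_right[OF finite_atoms_plus] mtransp_def)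

lemma Gam_nonneg: "Gam Ep w \<K> K L \<ge> 0"
proof (cases "K \<in> atoms_plus Ep w \<K> \<and> L \<in> atoms_plus Ep w \<K>")
  case True
  then show ?thesis
    using stochastic_on_walkQ
    by (auto simp: Gam_eq stochastic_on_def atoms_plus_def intro!: mult_nonneg_nonneg sum_nonneg)
qed (auto simp: Gam_def Let_def)

lemma sum_Gam: "(\<Sum>K\<in>\<K>. \<Sum>L\<in>\<K>. Gam Ep w \<K> K L) = (\<Sum>K\<in>\<K>. adeg Ep w \<K> K)"
proof -
  define I where "I = atoms_plus Ep w \<K>"
  define d where "d = adeg Ep w \<K>"
  define Q where "Q = walkQ Ep w \<K>"
  have I: "I \<subseteq> \<K>" "finite I" and d0: "\<And>K. K \<in> \<K> - I \<Longrightarrow> d K = 0" "\<And>K. K \<in> I \<Longrightarrow> d K > 0"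
    using finite_atoms_plus adeg_nonneg by (force simp: I_def d_def atoms_plus_def)+
  have Q: "stochastic_on I d Q"
    using stochastic_on_walkQ by (simp add: I_def d_def Q_def)
  have "(\<Sum>K\<in>\<K>. \<Sum>L\<in>\<K>. Gam Ep w \<K> K L) = (\<Sum>K\<in>I. \<Sum>L\<in>\<K>. Gam Ep w \<K> K L)"
    using I finite_parts by (intro sum.mono_neutral_right) (auto simp: Gam_def Let_def I_def)
  also have "\<dots> = (\<Sum>K\<in>I. \<Sum>L\<in>I. Gam Ep w \<K> K L)"
    using I finite_parts
    by (intro sum.cong refl sum.mono_neutral_right) (auto simp: Gam_def Let_def I_def)
  also have "\<dots> = (\<Sum>K\<in>I. \<Sum>L\<in>I. \<Sum>M\<in>I. d K * Q K M / d M * (d L * Q L M))"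
    by (intro sum.cong refl) (simp add: Gam_eq I_def d_def Q_def sum_distrib_left mult_ac)
  \<comment> \<open>Summing over \<open>L\<close> first lets stationarity produce
    \<open>d M\<close>, which cancels the division by \<open>d M\<close>; the row sums of
    \<open>Q\<close> then remove \<open>M\<close>.\<close>
  also have "\<dots> = (\<Sum>K\<in>I. \<Sum>M\<in>I. d K * Q K M / d M * (\<Sum>L\<in>I. d L * Q L M))"
    unfolding sum_distrib_left by (intro sum.cong refl sum.swap)
  also have "\<dots> = (\<Sum>K\<in>I. d K * (\<Sum>M\<in>I. Q K M))"
    unfolding sum_distrib_left[of "d _" "Q _"]
  proof (intro sum.cong refl)
    fix K M assume "K \<in> I" "M \<in> I"
    then show "d K * Q K M / d M * (\<Sum>L\<in>I. d L * Q L M) = d K * Q K M"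
      using Q d0(2)[of M] by (simp add: stochastic_on_def)
  qed
  also have "\<dots> = (\<Sum>K\<in>I. d K)"
    using Q by (simp add: stochastic_on_def)
  also have "\<dots> = (\<Sum>K\<in>\<K>. d K)"
    using I finite_parts d0 by (intro sum.mono_neutral_left) auto
  finally show ?thesis by (simp add: d_def)
qed

section \<open>From the mass of \<open>Gam\<close> to the weight of the admissible pairs\<close>

lemma edge_sum_partition:
  assumes "E \<subseteq> nsets V 2"
  shows "edge_sum E f =
    (\<Sum>K\<in>\<K>. \<Sum>L\<in>\<K>. \<Sum>u\<in>K. \<Sum>v\<in>L. if u \<noteq> v \<and> {u, v} \<in> E then f u v else 0) / 2"
  unfolding edge_sum_altdef[OF finite_V assms] sum.partition[OF finite_V part]
  by (intro arg_cong2[where f="(/)"] sum.cong refl sum.swap)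

lemma edge_sum_nonneg:
  assumes "E \<subseteq> nsets V 2"
  shows "edge_sum E w \<ge> 0"
  unfolding edge_sum_altdef[OF finite_V assms]
  using w_nonneg by (intro divide_nonneg_nonneg sum_nonneg) auto

text \<open>Each cut positive pair is counted from both of its atoms, hence the factor 2; the
  negative part of the objective is nonnegative.\<close>

lemma sum_adeg_le: "(\<Sum>K\<in>\<K>. adeg Ep w \<K> K) \<le> 2 * obj Ep Em w \<K>"
proof -
  let ?E = "{e \<in> Ep. \<not> (\<exists>C\<in>\<K>. e \<subseteq> C)}"
  have "(\<Sum>K\<in>\<K>. adeg Ep w \<K> K) = (\<Sum>K\<in>\<K>. \<Sum>L\<in>\<K>. if L = K then 0 else wpos Ep w K L)"
    unfolding adeg_def using finite_parts
    by (intro sum.cong refl sum.mono_neutral_cong_left) auto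
  also have "\<dots> \<le> (\<Sum>K\<in>\<K>. \<Sum>L\<in>\<K>. \<Sum>u\<in>K. \<Sum>v\<in>L. if u \<noteq> v \<and> {u, v} \<in> ?E then w u v else 0)"
  proof (intro sum_mono)
    fix K L assume KL: "K \<in> \<K>" "L \<in> \<K>"
    show "(if L = K then 0 else wpos Ep w K L)
      \<le> (\<Sum>u\<in>K. \<Sum>v\<in>L. if u \<noteq> v \<and> {u, v} \<in> ?E then w u v else 0)"
    proof (cases "L = K")
      case True
      then show ?thesis
        using KL part_subset w_nonneg by (auto intro!: sum_nonneg simp: subset_iff)
    next
      case False
      have "wpos Ep w K L = (\<Sum>u\<in>K. \<Sum>v\<in>L. if u \<noteq> v \<and> {u, v} \<in> ?E then w u v else 0)"
        unfolding wpos_def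
      proof (intro sum.cong refl)
        fix u v assume uv: "u \<in> K" "v \<in> L"
        then have "u \<noteq> v" "\<not> (\<exists>C\<in>\<K>. {u, v} \<subseteq> C)"
          using KL False part_unique by blast+
        then show "(if {u, v} \<in> Ep then w u v else 0) = (if u \<noteq> v \<and> {u, v} \<in> ?E then w u v else 0)"
          by simp
      qed
      then show ?thesis using False by simp
    qed
  qed
  also have "\<dots> = 2 * edge_sum ?E w"
    using pairs by (subst edge_sum_partition) auto
  also have "\<dots> \<le> 2 * obj Ep Em w \<K>"
    using edge_sum_nonneg[of "{e \<in> Em. \<exists>C\<in>\<K>. e \<subseteq> C}"] pairs by (auto simp: obj_def)
  finally show ?thesis .
qed

lemma adm_pairs_subset: "adm_pairs Ep w \<K> \<alpha> \<epsilon> \<subseteq> nsets V 2"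
  using part_subset part_unique by (fastforce simp: adm_pairs_def Let_def)

lemma adm_pairsD:
  assumes "{u, v} \<in> adm_pairs Ep w \<K> \<alpha> \<epsilon>" "u \<in> K" "v \<in> L" "K \<in> \<K>" "L \<in> \<K>"
  defines "c \<equiv> 64 / (\<epsilon> / (2 * \<alpha>)) ^ (2 * t0 + 1)"
  shows "K \<noteq> L" "wsum w K L < c * Gam Ep w \<K> K L \<or> wsum w L K < c * Gam Ep w \<K> L K"
proof -
  from assms obtain u' v' K' L' where *: "{u, v} = {u', v'}" "K' \<in> \<K>" "L' \<in> \<K>" "K' \<noteq> L'"
    "u' \<in> K'" "v' \<in> L'" "wsum w K' L' < c * Gam Ep w \<K> K' L'"
    unfolding adm_pairs_def Let_def c_def mem_Collect_eq by metis
  then have "K = K' \<and> L = L' \<or> K = L' \<and> L = K'"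
    using assms(2-5) part_unique by (metis doubleton_eq_iff)
  then show "K \<noteq> L" "wsum w K L < c * Gam Ep w \<K> K L \<or> wsum w L K < c * Gam Ep w \<K> L K"
    using * by auto
qed

text \<open>A single admissible pair between \<open>K\<close> and \<open>L\<close> already puts the
  whole weight between these atoms below the threshold, so the admissible weight is charged to the
  entries of \<open>Gam\<close>.\<close>

lemma edge_sum_adm_pairs_le:
  assumes "\<epsilon> > 0" "\<alpha> > 0"
  shows "edge_sum (adm_pairs Ep w \<K> \<alpha> \<epsilon>) w
    \<le> 128 * (2 * \<alpha> / \<epsilon>) ^ (2 * t0 + 1) * obj Ep Em w \<K>"
proof -
  define c where "c = 64 / (\<epsilon> / (2 * \<alpha>)) ^ (2 * t0 + 1)"
  have c: "c > 0" using assms by (simp add: c_def)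
  let ?A = "adm_pairs Ep w \<K> \<alpha> \<epsilon>" and ?G = "Gam Ep w \<K>"
  have "(\<Sum>u\<in>K. \<Sum>v\<in>L. if u \<noteq> v \<and> {u, v} \<in> ?A then w u v else 0) \<le> c * ?G K L + c * ?G L K"
    if KL: "K \<in> \<K>" "L \<in> \<K>" for K L
  proof (cases "\<exists>u\<in>K. \<exists>v\<in>L. {u, v} \<in> ?A")
    case True
    then have "wsum w K L < c * ?G K L \<or> wsum w L K < c * ?G L K"
      using adm_pairsD(2) KL unfolding c_def by meson
    moreover have "c * ?G K L \<ge> 0" "c * ?G L K \<ge> 0" using c Gam_nonneg by auto
    ultimately have "wsum w K L \<le> c * ?G K L + c * ?G L K"
      using wsum_commute[OF KL] by auto
    moreover have "(\<Sum>u\<in>K. \<Sum>v\<in>L. if u \<noteq> v \<and> {u, v} \<in> ?A then w u v else 0) \<le> wsum w K L"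
      unfolding wsum_def using KL part_subset w_nonneg by (intro sum_mono) (auto simp: subset_iff)
    ultimately show ?thesis by linarith
  next
    case False
    then have "(\<Sum>u\<in>K. \<Sum>v\<in>L. if u \<noteq> v \<and> {u, v} \<in> ?A then w u v else 0) = 0"
      by (intro sum.neutral ballI) auto
    then show ?thesis using c Gam_nonneg by simp
  qed
  then have "edge_sum ?A w \<le> (\<Sum>K\<in>\<K>. \<Sum>L\<in>\<K>. c * ?G K L + c * ?G L K) / 2"
    unfolding edge_sum_partition[OF adm_pairs_subset]
    by (intro divide_right_mono sum_mono) auto
  also have "\<dots> = (c * (\<Sum>K\<in>\<K>. \<Sum>L\<in>\<K>. ?G K L) + c * (\<Sum>K\<in>\<K>. \<Sum>L\<in>\<K>. ?G L K)) / 2"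
    by (simp only: sum.distrib sum_distrib_left)
  also have "(\<Sum>K\<in>\<K>. \<Sum>L\<in>\<K>. ?G L K) = (\<Sum>K\<in>\<K>. \<Sum>L\<in>\<K>. ?G K L)"
    by (rule sum.swap)
  \<comment> \<open>The two orders of the atoms cancel the half in \<open>edge_sum\<close>; 128 is
    the 64 of the threshold times the 2 of \<open>sum_adeg_le\<close>.\<close>
  also have "(c * (\<Sum>K\<in>\<K>. \<Sum>L\<in>\<K>. ?G K L) + c * (\<Sum>K\<in>\<K>. \<Sum>L\<in>\<K>. ?G K L)) / 2
    \<le> c * (2 * obj Ep Em w \<K>)"
    using c sum_adeg_le by (simp add: sum_Gam)
  also have "\<dots> = 128 * (2 * \<alpha> / \<epsilon>) ^ (2 * t0 + 1) * obj Ep Em w \<K>"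
    by (simp add: c_def power_divide)
  finally show ?thesis .
qed

end

section \<open>The sampling error\<close>

text \<open>Every seed set contains the first seed \<open>a\<close>; the triangle inequality through \<open>a\<close> leaves only the
  pairs \<open>{a, v}\<close> for which \<open>v\<close> is still undecided once \<open>a\<close> is known to be in the cluster.\<close>

lemma (in pseudo_cluster) sum_weighted_cov_le:
  assumes w_nonneg: "\<And>u v. \<lbrakk>u \<in> V; v \<in> V\<rbrakk> \<Longrightarrow> w u v \<ge> 0"
    and w_sym: "\<And>u v. \<lbrakk>u \<in> V; v \<in> V\<rbrakk> \<Longrightarrow> w u v = w v u"
    and w_tri: "\<And>u v a. \<lbrakk>u \<in> V; v \<in> V; a \<in> V\<rbrakk> \<Longrightarrow> w u v \<le> w u a + w a v"
    and A: "\<And>a v. \<lbrakk>a \<in> V; v \<in> V; a \<noteq> v; {a, v} \<notin> A\<rbrakk> \<Longrightarrow> y {a, v} = 0 \<or> y {a, v} = y {a}"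
    and m: "m + 2 \<le> r" and lam: "lam > 0"
  shows "(\<Sum>u\<in>V. \<Sum>v\<in>V. w u v * (\<Sum>t = 1..m. walk_mean V s t {} (\<lambda>U. cov U u v)))
    \<le> (\<Sum>a\<in>V. \<Sum>v\<in>V. if a \<noteq> v \<and> {a, v} \<in> A
         then 2 * w a v * (y {a} * (lam / 4 + m / (4 * lam))) else 0)"
proof -
  define F where "F U = (\<Sum>u\<in>V. \<Sum>v\<in>V. w u v * cov U u v)" for U
  define N where "N a = {v \<in> V. a \<noteq> v \<and> {a, v} \<in> A}" for a
  have N: "N a \<subseteq> V" "finite (N a)" for a using finV by (auto simp: N_def)
  have cov_nonneg: "cov U u v \<ge> 0" for U u v by (simp add: cov_def)
  have F: "F U \<le> (\<Sum>v\<in>N a. 2 * w a v * (\<Sum>u\<in>V. cov U u v))"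
    if "a \<in> U" "U \<subseteq> V" "card U + 2 \<le> r" for U a
  proof -
    have aV: "a \<in> V" using that by auto
    have "F U \<le> (\<Sum>u\<in>V. \<Sum>v\<in>V. (w u a + w a v) * cov U u v)"
      unfolding F_def using w_tri aV cov_nonneg by (intro sum_mono mult_right_mono) auto
    also have "\<dots> = (\<Sum>u\<in>V. \<Sum>v\<in>V. w u a * cov U u v) + (\<Sum>u\<in>V. \<Sum>v\<in>V. w a v * cov U u v)"
      by (simp add: distrib_right sum.distrib)
    also have "(\<Sum>u\<in>V. \<Sum>v\<in>V. w u a * cov U u v) = (\<Sum>v\<in>V. \<Sum>u\<in>V. w a v * cov U u v)"
      using w_sym aV by (intro sum.cong refl) (simp add: cov_commute)
    also have "(\<Sum>u\<in>V. \<Sum>v\<in>V. w a v * cov U u v) = (\<Sum>v\<in>V. \<Sum>u\<in>V. w a v * cov U u v)"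
      by (rule sum.swap)
    also have "(\<Sum>v\<in>V. \<Sum>u\<in>V. w a v * cov U u v) + (\<Sum>v\<in>V. \<Sum>u\<in>V. w a v * cov U u v)
      = (\<Sum>v\<in>V. 2 * w a v * (\<Sum>u\<in>V. cov U u v))"
      by (simp only: sum_distrib_left[symmetric] mult_2[symmetric] mult.assoc)
    also have "\<dots> = (\<Sum>v\<in>N a. 2 * w a v * (\<Sum>u\<in>V. cov U u v))"
    proof (rule sum.mono_neutral_right)
      show "\<forall>v\<in>V - N a. 2 * w a v * (\<Sum>u\<in>V. cov U u v) = 0"
      proof
        fix v assume v: "v \<in> V - N a"
        \<comment> \<open>The case \<open>a = v\<close> belongs here as well: a seed is decided by
          itself.\<close>
        have "y {a, v} = 0 \<or> y {a, v} = y {a}"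
          using v A[of a v] aV by (cases "a = v") (auto simp: N_def)
        then have "cov U u v = 0" if "u \<in> V" for u
          using that \<open>a \<in> U\<close> \<open>U \<subseteq> V\<close> \<open>card U + 2 \<le> r\<close> v by (intro cov_eq_0) auto
        then show "2 * w a v * (\<Sum>u\<in>V. cov U u v) = 0" by simp
      qed
    qed (use N finV in auto)
    finally show ?thesis .
  qed
  have "(\<Sum>u\<in>V. \<Sum>v\<in>V. w u v * (\<Sum>t = 1..m. walk_mean V s t {} (\<lambda>U. cov U u v)))
    = (\<Sum>t = 1..m. walk_mean V s t {} F)"
  proof -
    have "(\<Sum>t = 1..m. walk_mean V s t {} F)
      = (\<Sum>t = 1..m. \<Sum>u\<in>V. \<Sum>v\<in>V. w u v * walk_mean V s t {} (\<lambda>U. cov U u v))"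
      unfolding F_def using finV by (simp add: walk_mean_sum walk_mean_cmult)
    also have "\<dots> = (\<Sum>u\<in>V. \<Sum>t = 1..m. \<Sum>v\<in>V. w u v * walk_mean V s t {} (\<lambda>U. cov U u v))"
      by (rule sum.swap)
    also have "\<dots> = (\<Sum>u\<in>V. \<Sum>v\<in>V. \<Sum>t = 1..m. w u v * walk_mean V s t {} (\<lambda>U. cov U u v))"
      by (intro sum.cong refl sum.swap)
    finally show ?thesis by (simp add: sum_distrib_left)
  qed
  \<comment> \<open>At least one seed is always drawn, so a first seed \<open>a\<close> can be split
    off; \<open>t\<close> now counts the later seeds. The division by \<open>s\<close> will cancel
    the factor \<open>s\<close> of \<open>sum_walk_mean_cov_le\<close>.\<close>
  also have "\<dots> = (\<Sum>t<m. (\<Sum>a\<in>V. walk_mean V s t {a} F) / s)"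
    by (simp add: sum.atLeast1_atMost_eq)
  also have "\<dots> \<le> (\<Sum>t<m. (\<Sum>a\<in>V. \<Sum>v\<in>N a. 2 * w a v *
      walk_mean V s t {a} (\<lambda>U. \<Sum>u\<in>V. cov U u v)) / s)"
  proof (intro sum_mono divide_right_mono)
    fix t a assume t: "t \<in> {..<m}" and a: "a \<in> V"
    have "walk_mean V s t {a} F \<le> walk_mean V s t {a} (\<lambda>U. \<Sum>v\<in>N a. 2 * w a v * (\<Sum>u\<in>V. cov U u v))"
      using a t m s_pos by (intro walk_mean_mono F) auto
    then show "walk_mean V s t {a} F
      \<le> (\<Sum>v\<in>N a. 2 * w a v * walk_mean V s t {a} (\<lambda>U. \<Sum>u\<in>V. cov U u v))"
      by (simp only: walk_mean_sum[OF N(2)] walk_mean_cmult)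
  qed (use s_pos in auto)
  also have "\<dots> = (\<Sum>a\<in>V. \<Sum>v\<in>N a. 2 * w a v *
      (\<Sum>t<m. walk_mean V s t {a} (\<lambda>U. \<Sum>u\<in>V. cov U u v))) / s"
  proof -
    have "(\<Sum>t<m. \<Sum>a\<in>V. \<Sum>v\<in>N a. 2 * w a v * walk_mean V s t {a} (\<lambda>U. \<Sum>u\<in>V. cov U u v))
      = (\<Sum>a\<in>V. \<Sum>t<m. \<Sum>v\<in>N a. 2 * w a v * walk_mean V s t {a} (\<lambda>U. \<Sum>u\<in>V. cov U u v))"
      by (rule sum.swap)
    also have "\<dots> = (\<Sum>a\<in>V. \<Sum>v\<in>N a. \<Sum>t<m. 2 * w a v * walk_mean V s t {a} (\<lambda>U. \<Sum>u\<in>V. cov U u v))"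
      by (intro sum.cong refl sum.swap)
    finally show ?thesis by (simp only: sum_distrib_left sum_divide_distrib[symmetric])
  qed
  also have "\<dots> \<le> (\<Sum>a\<in>V. \<Sum>v\<in>N a. 2 * w a v * (s * y {a} * (lam / 4 + m / (4 * lam)))) / s"
    using w_nonneg m lam s_pos
    by (intro divide_right_mono sum_mono mult_left_mono sum_walk_mean_cov_le)
      (auto dest: subsetD[OF N(1)])
  also have "\<dots> = (\<Sum>a\<in>V. \<Sum>v\<in>N a. 2 * w a v * (y {a} * (lam / 4 + m / (4 * lam))))"
    using s_pos by (simp add: sum_divide_distrib mult.assoc mult.left_commute[of _ s])
  also have "\<dots> = (\<Sum>a\<in>V. \<Sum>v\<in>V. if a \<noteq> v \<and> {a, v} \<in> A
         then 2 * w a v * (y {a} * (lam / 4 + m / (4 * lam))) else 0)"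
    unfolding N_def using finV by (intro sum.cong refl sum.inter_filter)
  finally show ?thesis .
qed

text \<open>The inclusion-exclusion constraint for \<open>T = {v}\<close> is monotonicity, and for
  \<open>T = {u, v}\<close> it is supermodularity; coinciding or already present vertices reduce to
  the former.\<close>

lemma pseudo_cluster_lp_feasible:
  assumes feas: "lp_feasible V \<K> A r y" and fin: "finite V" and k: "k \<in> {1..card V}"
  shows "pseudo_cluster V r (real k) (y k)"
proof
  have inc: "0 \<le> (\<Sum>T'\<in>Pow T. (- 1) ^ card T' * y k (S \<union> T'))"
    if "S \<subseteq> V" "T \<subseteq> V" "S \<inter> T = {}" "card (S \<union> T) \<le> r" for S T
    using feas[unfolded lp_feasible_def, THEN conjunct2, THEN conjunct2, THEN conjunct2, THEN conjunct2, THEN conjunct2, rule_format, OF k that] by simp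
  show "(\<Sum>u\<in>V. y k (insert u S)) = real k * y k S" if "S \<subseteq> V" "card S \<le> r - 1" for S
  proof -
    have "1 / real k * (\<Sum>u\<in>V. y k (S \<union> {u})) = y k S"
      using feas[unfolded lp_feasible_def, THEN conjunct2, THEN conjunct1, rule_format, OF k that] .
    then show ?thesis using k by (auto simp: field_simps)
  qed
  show "0 \<le> y k S" if "S \<subseteq> V" "card S \<le> r" for S
    using feas[unfolded lp_feasible_def, THEN conjunct2, THEN conjunct2, THEN conjunct1, rule_format, OF k that] .
  show mono: "y k (insert v S) \<le> y k S" if "S \<subseteq> V" "v \<in> V" "card (insert v S) \<le> r" for S v
    using inc[of S "{v}"] that by (cases "v \<in> S") (auto simp: insert_absorb Pow_insert)
  show "y k (insert u S) + y k (insert v S) \<le> y k S + y k (insert u (insert v S))"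
    if "S \<subseteq> V" "u \<in> V" "v \<in> V" "card (insert u (insert v S)) \<le> r" for S u v
  proof (cases "u \<in> S \<or> v \<in> S \<or> u = v")
    case True
    then show ?thesis using that mono[of S u] by (auto simp: insert_absorb insert_commute)
  next
    case False
    have "Pow {u, v} = {{}, {u}, {v}, {u, v}}" by auto
    with inc[of S "{u, v}"] that False show ?thesis
      by (auto simp: insert_commute doubleton_eq_iff)
  qed
qed (use fin k in auto)

section \<open>Consequences of the LP constraints for atoms and inadmissible pairs\<close>

locale lp_solution = weighted_partition V Ep Em w \<K>
  for V :: "'a set" and Ep Em w \<K> +
  fixes A :: "'a set set" and r :: nat and y :: "nat \<Rightarrow> 'a set \<Rightarrow> real" and rep :: "'a set \<Rightarrow> 'a"
  assumes feas: "lp_feasible V \<K> A r y" and A: "A \<subseteq> nsets V 2" and r: "r \<ge> 3"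
    and rep: "\<And>K. K \<in> \<K> \<Longrightarrow> rep K \<in> K"
begin

lemma y_pseudo_cluster: "k \<in> {1..card V} \<Longrightarrow> pseudo_cluster V r (real k) (y k)"
  using pseudo_cluster_lp_feasible[OF feas finite_V] .

lemma ytot_singleton: "u \<in> V \<Longrightarrow> ytot V y {u} = 1"
  and ytot_same: "\<lbrakk>K \<in> \<K>; u \<in> K; v \<in> K; u \<noteq> v\<rbrakk> \<Longrightarrow> ytot V y {u, v} = 1"
  and ytot_not_adm: "\<lbrakk>K \<in> \<K>; L \<in> \<K>; K \<noteq> L; u \<in> K; v \<in> L; {u, v} \<notin> A\<rbrakk> \<Longrightarrow> ytot V y {u, v} = 0"
  using feas[unfolded lp_feasible_def, THEN conjunct1, rule_format]
    feas[unfolded lp_feasible_def, THEN conjunct2, THEN conjunct2, THEN conjunct2, THEN conjunct1, rule_format]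
    feas[unfolded lp_feasible_def, THEN conjunct2, THEN conjunct2, THEN conjunct2, THEN conjunct2, THEN conjunct1, rule_format] by auto

lemma ytot_empty_ge_1: "ytot V y {} \<ge> 1"
proof -
  obtain u where u: "u \<in> V"
    using inst by (fastforce simp: cc_instance_def)
  have "ytot V y {u} \<le> ytot V y {}"
    unfolding ytot_def using u r pseudo_cluster.mono[OF y_pseudo_cluster, of _ "{}" u]
    by (intro sum_mono) auto
  then show ?thesis using ytot_singleton[OF u] by simp
qed

text \<open>The inequality holds for every size, and over all sizes both sides sum to 1, so no size
  can have a strict inequality.\<close>

lemma same_part_pair_eq:
  assumes "k \<in> {1..card V}" "K \<in> \<K>" "u \<in> K" "v \<in> K"
  shows "y k {u, v} = y k {u}"
proof (cases "u = v")
  case False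
  have uv: "u \<in> V" "v \<in> V" using assms part_subset by auto
  have "y i {u, v} \<le> y i {u}" if "i \<in> {1..card V}" for i
    using pseudo_cluster.mono[OF y_pseudo_cluster[OF that], of "{u}" v] uv r False
    by (auto simp: insert_commute)
  moreover have "(\<Sum>i\<in>{1..card V}. y i {u, v}) = (\<Sum>i\<in>{1..card V}. y i {u})"
    using ytot_same[of K u v] ytot_singleton[of u] assms uv False by (simp add: ytot_def)
  ultimately show ?thesis
    using assms(1) by (intro sum_mono_inv[of "\<lambda>i. y i {u, v}" "{1..card V}" "\<lambda>i. y i {u}"]) auto
qed auto

text \<open>The gap of the pair is zero at the empty set, and gaps only shrink.\<close>

lemma same_part_insert_eq:
  assumes k: "k \<in> {1..card V}" and K: "K \<in> \<K>" "u \<in> K" "v \<in> K"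
    and S: "S \<subseteq> V" "card S + 2 \<le> r"
  shows "y k (insert u (insert v S)) = y k (insert u S)"
proof -
  interpret ps: pseudo_cluster V r "real k" "y k" using y_pseudo_cluster[OF k] .
  have uv: "u \<in> V" "v \<in> V" using K part_subset by auto
  have "y k (insert u S) - y k (insert u (insert v S)) \<le> y k {u} - y k {u, v}"
    using ps.gap_antimono[of "{}" S u v] uv S by auto
  moreover have "card (insert v (insert u S)) \<le> r"
    using S ps.card_insert_bound[of 2 S u] ps.card_insert_bound[of 1 "insert u S" v] by auto
  then have "y k (insert u (insert v S)) \<le> y k (insert u S)"
    using ps.mono[of "insert u S" v] uv S by (auto simp: insert_commute)
  ultimately show ?thesis using same_part_pair_eq[OF k K] by simp
qed

text \<open>Inside one atom the two values agree; across atoms a zero sum of nonnegative terms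
  vanishes at every size.\<close>

lemma not_adm_decided:
  assumes k: "k \<in> {1..card V}" and uv: "a \<in> V" "v \<in> V" "{a, v} \<notin> A"
  shows "y k {a, v} = 0 \<or> y k {a, v} = y k {a}"
proof -
  obtain K L where KL: "K \<in> \<K>" "L \<in> \<K>" "a \<in> K" "v \<in> L"
    using uv partition_onD1[OF part] by auto
  show ?thesis
  proof (cases "K = L")
    case True
    then show ?thesis using same_part_pair_eq[OF k] KL by auto
  next
    case False
    have nn: "y i {a, v} \<ge> 0" if "i \<in> {1..card V}" for i
      using pseudo_cluster.nonneg[OF y_pseudo_cluster[OF that], of "{a, v}"] uv r
      by (auto simp: card_insert_if)
    have "(\<Sum>i\<in>{1..card V}. y i {a, v}) = 0"
      using ytot_not_adm[OF KL(1,2) False KL(3,4) uv(3)] by (simp add: ytot_def)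
    then have "y k {a, v} = 0"
      using nn k by (subst (asm) sum_nonneg_eq_0_iff) auto
    then show ?thesis by simp
  qed
qed

text \<open>For one atom the shared coin has exactly the right probability and the error is zero.
  For distinct atoms independent coins replace the joint law, and the error is the covariance
  itself.\<close>

lemma pick_atoms_error_le:
  assumes k: "k \<in> {1..card V}" and uv: "u \<in> V" "v \<in> V" and U: "U \<subseteq> V" "card U + 2 \<le> r"
  shows "\<bar>y k U * measure_pmf.prob (pick_atoms \<K> rep y k U) {C. u \<in> C \<and> v \<in> C}
      - y k (insert u (insert v U))\<bar> \<le> pseudo_cluster.cov (y k) U u v"
proof -
  interpret ps: pseudo_cluster V r "real k" "y k" using y_pseudo_cluster[OF k] .
  obtain K L where KL: "K \<in> \<K>" "L \<in> \<K>" "u \<in> K" "v \<in> L"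
    using uv partition_onD1[OF part] by auto
  have c: "card (insert x U) + 1 \<le> r" "card (insert x (insert z U)) \<le> r" for x z
    using U ps.card_insert_bound[of 2 U x] ps.card_insert_bound[of 2 U z]
        ps.card_insert_bound[of 1 "insert z U" x] by auto
  show ?thesis
  proof (cases "y k U = 0")
    case True
    have "y k (insert u (insert v U)) = 0"
      using ps.antimono[of U "insert u (insert v U)"] ps.nonneg[of "insert u (insert v U)"]
        uv U c True by auto
    then show ?thesis using True by (simp add: ps.cov_def)
  next
    case False
    then have pos: "y k U > 0" using ps.nonneg[of U] U by auto
    have rep_eq: "y k (insert (rep M) U) = y k (insert x U)" if "M \<in> \<K>" "x \<in> M" for M x
      using same_part_insert_eq[OF k that(1) that(2) rep[OF that(1)] U]
        same_part_insert_eq[OF k that(1) rep[OF that(1)] that(2) U] by (simp add: insert_commute)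
    have range: "0 \<le> y k (U \<union> {rep M}) / y k U" "y k (U \<union> {rep M}) / y k U \<le> 1" if "M \<in> \<K>" for M
      using subsetD[OF part_subset[OF that] rep[OF that]] pos U c(1)[of "rep M"]
        ps.nonneg[of "insert (rep M) U"] ps.mono[of U "rep M"]
      by (auto simp: divide_le_eq)
    have prob: "measure_pmf.prob (pick_atoms \<K> rep y k U) {C. u \<in> C \<and> v \<in> C}
      = (\<Prod>M\<in>{K, L}. y k (insert (rep M) U) / y k U)"
      using prob_pick_atoms[where y = y and s = k and U = U and rep = rep,
          OF part finite_parts KL range[OF KL(1)] range[OF KL(2)]] by simp
    show ?thesis
    proof (cases "K = L")
      case True
      then show ?thesis
        using pos prob rep_eq[OF KL(1) KL(3)] same_part_insert_eq[OF k KL(1) KL(3) _ U, of v] KL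
        by (simp add: ps.cov_def)
    next
      case False
      then show ?thesis
        using pos prob rep_eq[OF KL(1) KL(3)] rep_eq[OF KL(2) KL(4)] by (simp add: ps.cov_def)
    qed
  qed
qed

text \<open>The value \<open>y k {}\<close> in the law of the size is the initial factor that
  \<open>prob_pick_seeds_bind\<close> requires.\<close>

lemma prob_sample_one_cluster:
  "measure_pmf.prob (sample_one_cluster V \<K> r rep y) X =
    (\<Sum>k = 1..card V. (\<Sum>t = 1..r - 2. walk_mean V (real k) t {}
        (\<lambda>U. y k U * measure_pmf.prob (pick_atoms \<K> rep y k U) X)) / real (r - 2)) / ytot V y {}"
proof -
  have Y: "ytot V y {} > 0" using ytot_empty_ge_1 by simp
  have nn: "y k {} \<ge> 0" if "k \<in> {1..card V}" for k
    using pseudo_cluster.nonneg[OF y_pseudo_cluster[OF that], of "{}"] by simp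
  let ?h = "\<lambda>k t. measure_pmf.prob (pick_seeds V y k t {} \<bind> pick_atoms \<K> rep y k) X"
  have "measure_pmf.prob (sample_one_cluster V \<K> r rep y) X
    = measure_pmf.expectation (pick_size V y) (\<lambda>k. (\<Sum>t = 1..r - 2. ?h k t) / real (r - 2))"
    unfolding sample_one_cluster_def using r
    by (simp add: prob_bind_pmf[of "pick_size V y"] prob_bind_pmf[of "pmf_of_set _"]
        integral_pmf_of_set)
  also have "\<dots> = (\<Sum>k = 1..card V. y k {} / ytot V y {} * ((\<Sum>t = 1..r - 2. ?h k t) / real (r - 2)))"
    unfolding pick_size_def
    using nn Y by (intro expectation_embed_pmf) (auto simp: ytot_def sum_divide_distrib[symmetric])
  also have "\<dots> = (\<Sum>k = 1..card V. (\<Sum>t = 1..r - 2. y k {} * ?h k t) / real (r - 2)) / ytot V y {}"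
    by (simp add: sum_distrib_left sum_divide_distrib mult_ac)
  also have "\<dots> = (\<Sum>k = 1..card V. (\<Sum>t = 1..r - 2. walk_mean V (real k) t {}
        (\<lambda>U. y k U * measure_pmf.prob (pick_atoms \<K> rep y k U) X)) / real (r - 2)) / ytot V y {}"
    by (intro arg_cong2[where f="(/)"] sum.cong refl
        pseudo_cluster.prob_pick_seeds_bind[OF y_pseudo_cluster]) auto
  finally show ?thesis .
qed

section \<open>The error of one pair\<close>

lemma pair_error_le:
  assumes uv: "u \<in> V" "v \<in> V"
  shows "\<bar>measure_pmf.prob (sample_one_cluster V \<K> r rep y) {C. u \<in> C \<and> v \<in> C}
      - ytot V y {u, v} / ytot V y {}\<bar>
    \<le> (\<Sum>k = 1..card V. (\<Sum>t = 1..r - 2. walk_mean V (real k) t {}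
        (\<lambda>U. pseudo_cluster.cov (y k) U u v)) / real (r - 2)) / ytot V y {}"
proof -
  let ?W = "\<lambda>k t. walk_mean V (real k) t {}"
  let ?q = "\<lambda>k U. y k U * measure_pmf.prob (pick_atoms \<K> rep y k U) {C. u \<in> C \<and> v \<in> C}"
  let ?e = "\<lambda>k U. ?q k U - y k (U \<union> {u, v})"
  have Y: "ytot V y {} > 0" using ytot_empty_ge_1 by simp
  have m: "real (r - 2) > 0" using r by simp
  have uv_card: "card {u, v} \<le> 2" by (simp add: card_insert_if)
  \<comment> \<open>The target itself is written as a walk mean for every \<open>t\<close>, so the
    error becomes an average of local errors. Adding \<open>u\<close> and \<open>v\<close> to at
    most \<open>r - 2\<close> seeds just fits into rank \<open>r\<close>.\<close>
  have mart: "?W k t (\<lambda>U. y k (U \<union> {u, v})) = y k {u, v}"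
    if "k \<in> {1..card V}" "t \<in> {1..r - 2}" for k t
    using pseudo_cluster.walk_mean_martingale[OF y_pseudo_cluster[OF that(1)], of "{}" "{u, v}" t] that uv uv_card
    by auto
  have err: "\<bar>?W k t (?e k)\<bar> \<le> ?W k t (\<lambda>U. pseudo_cluster.cov (y k) U u v)"
    if "k \<in> {1..card V}" "t \<in> {1..r - 2}" for k t
  proof -
    have "\<bar>?W k t (?e k)\<bar> \<le> ?W k t (\<lambda>U. \<bar>?e k U\<bar>)"
      by (intro walk_mean_abs_le) auto
    also have "\<dots> \<le> ?W k t (\<lambda>U. pseudo_cluster.cov (y k) U u v)"
      using that pick_atoms_error_le[OF that(1) uv] r by (intro walk_mean_mono) auto
    finally show ?thesis .
  qed
  have "ytot V y {u, v} = (\<Sum>k = 1..card V. (\<Sum>t = 1..r - 2. ?W k t (\<lambda>U. y k (U \<union> {u, v}))) / real (r - 2))"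
    unfolding ytot_def using m mart by (intro sum.cong refl) (simp add: field_simps)
  then have eq: "measure_pmf.prob (sample_one_cluster V \<K> r rep y) {C. u \<in> C \<and> v \<in> C}
      - ytot V y {u, v} / ytot V y {}
    = (\<Sum>k = 1..card V. (\<Sum>t = 1..r - 2. ?W k t (?e k)) / real (r - 2)) / ytot V y {}"
    by (simp only: prob_sample_one_cluster walk_mean_diff sum_subtractf diff_divide_distrib)
  have "\<bar>\<Sum>k = 1..card V. (\<Sum>t = 1..r - 2. ?W k t (?e k)) / real (r - 2)\<bar>
    \<le> (\<Sum>k = 1..card V. (\<Sum>t = 1..r - 2. ?W k t
      (\<lambda>U. pseudo_cluster.cov (y k) U u v)) / real (r - 2))"
  proof (rule order.trans[OF sum_abs sum_mono])
    fix k assume k: "k \<in> {1..card V}"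
    have "\<bar>\<Sum>t = 1..r - 2. ?W k t (?e k)\<bar>
      \<le> (\<Sum>t = 1..r - 2. ?W k t (\<lambda>U. pseudo_cluster.cov (y k) U u v))"
      by (rule order.trans[OF sum_abs sum_mono]) (rule err[OF k])
    then show "\<bar>(\<Sum>t = 1..r - 2. ?W k t (?e k)) / real (r - 2)\<bar>
      \<le> (\<Sum>t = 1..r - 2. ?W k t (\<lambda>U. pseudo_cluster.cov (y k) U u v)) / real (r - 2)"
      using m by (simp only: abs_divide abs_of_pos divide_right_mono less_imp_le)
  qed
  then show ?thesis
    unfolding eq using Y by (simp only: abs_divide abs_of_pos divide_right_mono less_imp_le)
qed

section \<open>Summing the error over all pairs and sizes\<close>

lemma total_error_le:
  assumes lam: "lam > 0" and r_lam: "real (r - 2) \<ge> lam\<^sup>2"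
  shows "edge_sum (nsets V 2) (\<lambda>u v. w u v *
      \<bar>measure_pmf.prob (sample_one_cluster V \<K> r rep y) {C. u \<in> C \<and> v \<in> C}
        - ytot V y {u, v} / ytot V y {}\<bar>)
    \<le> edge_sum A w / lam / ytot V y {}"
proof -
  let ?err = "\<lambda>u v. \<bar>measure_pmf.prob (sample_one_cluster V \<K> r rep y) {C. u \<in> C \<and> v \<in> C}
        - ytot V y {u, v} / ytot V y {}\<bar>"
  define m where "m = r - 2"
  let ?cov = "\<lambda>k u v. \<Sum>t = 1..m. walk_mean V (real k) t {} (\<lambda>U. pseudo_cluster.cov (y k) U u v)"
  let ?a = "\<lambda>a v c. if a \<noteq> v \<and> {a, v} \<in> A then c else (0 :: real)"
  have Y: "ytot V y {} > 0" using ytot_empty_ge_1 by simp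
  have m: "real m > 0" "m + 2 \<le> r" "real m \<ge> lam\<^sup>2" using r r_lam by (auto simp: m_def)
  have "2 * edge_sum (nsets V 2) (\<lambda>u v. w u v * ?err u v) \<le> (\<Sum>u\<in>V. \<Sum>v\<in>V. w u v * ?err u v)"
    unfolding edge_sum_altdef[OF finite_V order.refl] using w_nonneg
    by (auto intro!: sum_mono)
  also have "\<dots> \<le> (\<Sum>u\<in>V. \<Sum>v\<in>V. w u v * ((\<Sum>k = 1..card V. ?cov k u v / real m) / ytot V y {}))"
    using w_nonneg unfolding m_def by (intro sum_mono mult_left_mono pair_error_le) auto
  also have "\<dots> = (\<Sum>u\<in>V. \<Sum>v\<in>V. \<Sum>k = 1..card V. w u v * ?cov k u v) / (real m * ytot V y {})"
    by (simp add: sum_distrib_left sum_divide_distrib)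
  also have "(\<Sum>u\<in>V. \<Sum>v\<in>V. \<Sum>k = 1..card V. w u v * ?cov k u v)
    = (\<Sum>u\<in>V. \<Sum>k = 1..card V. \<Sum>v\<in>V. w u v * ?cov k u v)"
    by (intro sum.cong refl sum.swap)
  also have "\<dots> = (\<Sum>k = 1..card V. \<Sum>u\<in>V. \<Sum>v\<in>V. w u v * ?cov k u v)"
    by (rule sum.swap)
  also have "\<dots> / (real m * ytot V y {}) \<le> (\<Sum>k = 1..card V. \<Sum>a\<in>V. \<Sum>v\<in>V.
      ?a a v (2 * w a v * (y k {a} * (lam / 4 + m / (4 * lam))))) / (real m * ytot V y {})"
    using Y m lam w_nonneg w_sym w_tri not_adm_decided
    by (intro divide_right_mono sum_mono pseudo_cluster.sum_weighted_cov_le[OF y_pseudo_cluster])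
      auto
  also have "(\<Sum>k = 1..card V. \<Sum>a\<in>V. \<Sum>v\<in>V. ?a a v (2 * w a v * (y k {a} * (lam / 4 + m / (4 * lam)))))
    = (\<Sum>a\<in>V. \<Sum>k = 1..card V. \<Sum>v\<in>V. ?a a v (2 * w a v * (y k {a} * (lam / 4 + m / (4 * lam)))))"
    by (rule sum.swap)
  also have "\<dots> = (\<Sum>a\<in>V. \<Sum>v\<in>V. \<Sum>k = 1..card V. ?a a v (2 * w a v * (y k {a} * (lam / 4 + m / (4 * lam)))))"
    by (intro sum.cong refl sum.swap)
  \<comment> \<open>The constraint \<open>ytot V y {a} = 1\<close> absorbs the sum over
    sizes.\<close>
  also have "\<dots> = (\<Sum>a\<in>V. \<Sum>v\<in>V. ?a a v (w a v) * (2 * (lam / 4 + m / (4 * lam))))"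
  proof (intro sum.cong refl)
    fix a v assume "a \<in> V" "v \<in> V"
    then have "(\<Sum>k = 1..card V. y k {a}) = 1" using ytot_singleton[of a] by (simp add: ytot_def)
    moreover have "(\<Sum>k = 1..card V. 2 * w a v * (y k {a} * (lam / 4 + m / (4 * lam))))
      = 2 * w a v * ((\<Sum>k = 1..card V. y k {a}) * (lam / 4 + m / (4 * lam)))"
      by (simp only: sum_distrib_left sum_distrib_right)
    ultimately show "(\<Sum>k = 1..card V. ?a a v (2 * w a v * (y k {a} * (lam / 4 + m / (4 * lam)))))
      = ?a a v (w a v) * (2 * (lam / 4 + m / (4 * lam)))"
      by simp
  qed
  also have "\<dots> = 2 * edge_sum A w * (2 * (lam / 4 + m / (4 * lam)))"
    unfolding edge_sum_altdef[OF finite_V A] by (simp add: sum_distrib_right)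
  \<comment> \<open>Since \<open>lam\<close> squared is at most \<open>m\<close>, the term
    \<open>lam / 2\<close> is at most \<open>m / (2 * lam)\<close>.\<close>
  also have "\<dots> \<le> 2 * edge_sum A w * (real m / lam)"
    using m lam edge_sum_nonneg[OF A]
    by (intro mult_left_mono) (auto simp: field_simps power2_eq_square)
  finally show ?thesis
    using m Y lam by (simp add: divide_right_mono field_simps)
qed

end

section \<open>Choice of the parameters and conclusion\<close>

theorem lemma5p4:
  fixes V :: "'a set" and Ep Em \<C>0 \<K> A :: "'a set set" and w :: "'a \<Rightarrow> 'a \<Rightarrow> real"
    and \<alpha> \<beta> \<epsilon> :: real and r :: nat
    and y :: "nat \<Rightarrow> 'a set \<Rightarrow> real" and rep :: "'a set \<Rightarrow> 'a"
  assumes inst: "cc_instance V Ep Em w"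
    and eps: "0 < \<epsilon>" "\<epsilon> \<le> 1"
    and beta: "0 < \<beta>" "\<beta> \<le> (2 * sqrt 7 - 5) / 6"
    and alpha: "atom_constant TYPE('a) \<beta> \<alpha>"
    and C0: "partition_on V \<C>0" "obj Ep Em w \<C>0 \<le> 20 / 3 * opt V Ep Em w"
    and K: "\<K> = atoms Ep w \<beta> \<C>0"
    and A: "A = adm_pairs Ep w \<K> \<alpha> \<epsilon>"
    and r: "r = lp_rank \<alpha> \<epsilon>"
    and y: "lp_optimal V Ep Em w \<K> A r y"
    and rep: "\<forall>K\<in>\<K>. rep K \<in> K"
  shows "edge_sum (nsets V 2)
           (\<lambda>u v. w u v *
              \<bar>measure_pmf.prob (sample_one_cluster V \<K> r rep y) {C. u \<in> C \<and> v \<in> C}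
                - ytot V y {u, v} / ytot V y {}\<bar>)
         \<le> \<epsilon> * opt V Ep Em w / ytot V y {}"
proof -
  define R where "R = R_const \<alpha> \<epsilon>"
  \<comment> \<open>Chosen so that an admissible weight of at most \<open>R\<close> times the
    optimum, divided by \<open>lam\<close>, is at most \<epsilon> times the optimum.\<close>
  define lam where "lam = R / \<epsilon>"
  have \<alpha>: "\<alpha> \<ge> 1" and obj: "obj Ep Em w \<K> \<le> \<alpha> * opt V Ep Em w"
    using alpha inst C0 by (auto simp: atom_constant_def K)
  interpret P: weighted_partition V Ep Em w \<K>
    using inst partition_on_atoms[OF C0(1)] by unfold_locales (simp_all add: K)
  have R: "R \<ge> 1" "R \<ge> 128 * \<alpha> * (2 * \<alpha> / \<epsilon>) ^ (2 * t0 + 1)"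
    by (auto simp: R_def R_const_def)
  have lam: "lam \<ge> 1" using R eps by (simp add: lam_def)
  have "1 \<le> lam\<^sup>2" using lam by (simp add: one_le_power)
  \<comment> \<open>As \<open>2 * ln 2\<close> exceeds 1, the ceiling in \<open>lp_rank\<close>
    dominates the square of \<open>lam\<close>, which is at least 1; this yields both bounds on
    \<open>r\<close>.\<close>
  moreover have "lam\<^sup>2 \<le> 2 * ln 2 * lam\<^sup>2"
    using mult_right_mono[of 1 "2 * ln 2" "lam\<^sup>2"] ln2_ge_two_thirds by simp
  moreover define n where "n = nat \<lceil>2 * ln 2 * lam\<^sup>2\<rceil>"
  moreover have "2 * ln 2 * lam\<^sup>2 \<le> real n"
    unfolding n_def by (rule real_nat_ceiling_ge)
  moreover have "r = 2 + n"
    by (simp add: r lp_rank_def lam_def R_def power_divide n_def)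
  ultimately have r': "r \<ge> 3" "real (r - 2) \<ge> lam\<^sup>2"
    by linarith+
  interpret S: lp_solution V Ep Em w \<K> A r y rep
    using y A P.adm_pairs_subset r' rep by unfold_locales (auto simp: lp_optimal_def)
  have pos: "128 * (2 * \<alpha> / \<epsilon>) ^ (2 * t0 + 1) > 0" using \<alpha> eps by simp
  have "edge_sum A w \<le> 128 * (2 * \<alpha> / \<epsilon>) ^ (2 * t0 + 1) * obj Ep Em w \<K>"
    unfolding A using \<alpha> eps by (intro P.edge_sum_adm_pairs_le) auto
  also have "\<dots> \<le> 128 * (2 * \<alpha> / \<epsilon>) ^ (2 * t0 + 1) * (\<alpha> * opt V Ep Em w)"
    using obj pos by (intro mult_left_mono) auto
  finally have *: "edge_sum A w \<le> (128 * \<alpha> * (2 * \<alpha> / \<epsilon>) ^ (2 * t0 + 1)) * opt V Ep Em w"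
    by (simp only: mult_ac)
  \<comment> \<open>Read off from the bound just obtained: a positive multiple of the optimum
    dominates a nonnegative weight. The sign is what allows the constant to be enlarged to
    \<open>R\<close>.\<close>
  have "opt V Ep Em w \<ge> 0"
  proof -
    have "0 < 128 * \<alpha> * (2 * \<alpha> / \<epsilon>) ^ (2 * t0 + 1)" using \<alpha> eps by simp
    moreover have "0 \<le> (128 * \<alpha> * (2 * \<alpha> / \<epsilon>) ^ (2 * t0 + 1)) * opt V Ep Em w"
      using * P.edge_sum_nonneg[OF S.A] by linarith
    ultimately show ?thesis by (metis linorder_not_le mult_pos_neg)
  qed
  then have "edge_sum A w \<le> R * opt V Ep Em w"
    using * mult_right_mono[OF R(2), of "opt V Ep Em w"] by linarith
  then have "edge_sum A w / lam \<le> \<epsilon> * opt V Ep Em w"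
    using R(1) eps by (simp add: lam_def field_simps)
  then have "edge_sum A w / lam / ytot V y {} \<le> \<epsilon> * opt V Ep Em w / ytot V y {}"
    using S.ytot_empty_ge_1 by (intro divide_right_mono) auto
  with S.total_error_le[of lam] lam r'(2) show ?thesis by linarith
qed

end
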